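(* Consider the two-color urn model described in the context, in either of the two cases "$m_A>m_B$" or "$m_A=m_B$" defined there. Assume that $$E[N_{n+1}\,|\,\mathcal{F}_n]\to N \quad\text{and}\quad E[N_{n+1}^2\,|\,\mathcal{F}_n]\to Q\qquad\text{almost surely},$$ where $N$ and $Q$ are finite, strictly positive random variables. Set $N_{A,n}=\sum_{j=1}^nX_j$ and $N_{B,n}=\sum_{j=1}^n(N_j-X_j)$. Then, in both cases: (i) $\widehat{\mu}_n=\frac1n\sum_{j=1}^n N_j$ and $\widehat{q}_{N,n}=\frac1n\sum_{j=1}^n N_j^2$ are strongly consistent estimators of $N$ and $Q$, i.e. $\widehat{\mu}_n\to N$ and $\widehat{q}_{N,n}\to Q$ almost surely. (ii) The random variables $$\widehat{m}_{A,n}=\frac{\sum_{j=1}^n A_jX_j}{N_{A,n}},\qquad \widehat{m}_{B,n}=\frac{\sum_{j=1}^n B_j(N_j-X_j)}{N_{B,n}}$$ are strongly consistent estimators of $m_A$ and $m_B$, i.e. they converge almost surely to $m_A$ and $m_B$, respectively. (iii) If in addition $E[A_n^2]\to q_A$ and $E[B_n^2]\to q_B$, then $$\widehat{q}_{A,n}=\frac{\sum_{j=1}^n A_j^2X_j}{N_{A,n}}\qquad\text{and}\qquad \widehat{q}_{B,n}=\frac{\sum_{j=1}^n B_j^2(N_j-X_j)}{N_{B,n}}$$ converge almost surely to $q_A$ and $q_B$, respectively. (iv) If $E[A_nB_n]\to q_{AB}$ and $P(N=1)<1$, then $$\widehat{q}_{AB,n}=\frac{\sum_{j=1}^n A_jB_jX_j(N_j-X_j)}{\sum_{j=1}^nX_j(N_j-X_j)}\to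 q_{AB}\qquad\text{almost surely on } \{N>1\}.$$
   Context: Urn model. An urn initially contains $a\ge 1$ balls of color A and $b\ge 1$ balls of color B ($a,b$ integers). On a probability space $(\Omega,\mathcal{A},P)$ there are random variables $N_n,X_n,A_n,B_n$, $n\ge1$. At each time $n\ge 1$, $N_n$ balls are drawn simultaneously without replacement, $X_n$ of them are of color A, and they are returned to the urn together with $A_nX_n$ new balls of color A and $B_n(N_n-X_n)$ new balls of color B. Define $$H_n=a+\sum_{j=1}^n A_jX_j,\qquad K_n=b+\sum_{j=1}^n B_j(N_j-X_j),\qquad S_n=H_n+K_n$$ (numbers of A balls, of B balls, and of all balls after step $n$; $H_0=a$, $K_0=b$). Let $\mathcal{F}_0$ be the trivial $\sigma$-field and $\mathcal{F}_n=\sigma(N_1,X_1,A_1,B_1,\dots,N_n,X_n,A_n,B_n)$ for $n\ge1$. For each $n\ge1$ it is assumed that: (A1) the conditional distribution of $N_n$ given $\mathcal{F}_{n-1}$ is concentrated on $\{1,\dots,S_{n-1}\}$ (and is otherwise arbitrary); (A2) the conditional distribution of $X_n$ given $\mathcal{F}_{n-1}\vee\sigma(N_n)$ is hypergeometric with parameters $N_n,S_{n-1},H_{n-1}$, i.e. the number of color-A balls in a sample without replacement of size $N_n$ from $S_{n-1}$ balls of which $H_{n-1}$ are of color A; (A3) the random vector $[A_n,B_n]$ takes values in $\{1,2,\dots\}^2$ and is independent of $\mathcal{F}_{n-1}\vee\sigma(N_n,X_n)$ (its joint distribution is otherwise arbitrary and may depend on $n$). Standing assumption: there is an integer constant $C$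 with $A_n\vee B_n\vee N_n\le C$ for all $n$. Put $m_{A,n}=E[A_n]$, $m_{B,n}=E[B_n]$, and assume $m_{A,n}\to m_A<+\infty$, $m_{B,n}\to m_B<+\infty$. The two cases are: Case $m_A>m_B$: $m_A>m_B$ and $\sum_n |m_{A,n+1}m_B-m_A m_{B,n+1}|/n<+\infty$. Case $m_A=m_B$: $m_{A,n}=m_{B,n}$ for each $n$ (hence $m_A=m_B\in[1,+\infty)$). Ratios are considered once their denominators are nonzero. *)

theory Defs
  imports "HOL-Probability.Probability"
begin

definition hypergeometric_pmf :: "nat \<Rightarrow> nat \<Rightarrow> nat \<Rightarrow> nat pmf" where
  "hypergeometric_pmf n s h =
     map_pmf (\<lambda>T. card (T \<inter> {..<h})) (pmf_of_set {T. T \<subseteq> {..<s} \<and> card T = n})"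

lemma pmf_hypergeometric:
  assumes "n \<le> s" "h \<le> s"
  shows "pmf (hypergeometric_pmf n s h) k =
    (if k \<le> n then real (h choose k) * real ((s - h) choose (n - k)) / real (s choose n) else 0)"
proof -
  let ?U = "{T. T \<subseteq> {..<s} \<and> card T = n}"
  let ?V = "?U \<inter> (\<lambda>T. card (T \<inter> {..<h})) -` {k}"
  have fin: "finite ?U" by (rule finite_subset[of _ "Pow {..<s}"]) auto
  have cardU: "card ?U = s choose n" by (simp add: n_subsets)
  hence ne: "?U \<noteq> {}" using assms by (metis binomial_eq_0_iff card.empty not_le)
  have *: "pmf (hypergeometric_pmf n s h) k = real (card ?V) / real (s choose n)"
    using cardU unfolding hypergeometric_pmf_def pmf_map
    by (subst measure_pmf_of_set[OF ne fin]) (simp add: Int_commute)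
  have split: "card T = card (T \<inter> {..<h}) + card (T - {..<h})" if "T \<subseteq> {..<s}" for T
    by (metis that card_Int_Diff finite_lessThan finite_subset)
  show ?thesis
  proof (cases "k \<le> n")
    case False
    have "?V = {}"
    proof (rule ccontr)
      assume "?V \<noteq> {}"
      then obtain T where "T \<subseteq> {..<s}" "card T = n" "card (T \<inter> {..<h}) = k" by auto
      with split[of T] False show False by linarith
    qed
    thus ?thesis using * False by simp
  next
    case True
    let ?P = "{T. T \<subseteq> {..<h} \<and> card T = k}" and ?R = "{T. T \<subseteq> {h..<s} \<and> card T = n - k}"
    have "bij_betw (\<lambda>T. (T \<inter> {..<h}, T - {..<h})) ?V (?P \<times> ?R)"
    proof (rule bij_betwI[where g = "\<lambda>(T, T'). T \<union> T'"])
      show "(\<lambda>T. (T \<inter> {..<h}, T - {..<h})) \<in> ?V \<rightarrow> ?P \<times> ?R"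
      proof (clarify, intro conjI SigmaI CollectI)
        fix T assume T: "T \<subseteq> {..<s}" "n = card T" "k = card (T \<inter> {..<h})"
        show "T - {..<h} \<subseteq> {h..<s}" using T(1) by (fastforce simp: not_less)
        show "card (T - {..<h}) = card T - card (T \<inter> {..<h})" using split[OF T(1)] by linarith
      qed simp_all
      show "(\<lambda>(T, T'). T \<union> T') \<in> ?P \<times> ?R \<rightarrow> ?V"
      proof (clarify, intro IntI CollectI conjI)
        fix T T' assume a: "T \<subseteq> {..<h}" "k = card T" "T' \<subseteq> {h..<s}" "card T' = n - card T"
        show sub: "T \<union> T' \<subseteq> {..<s}" using a assms by fastforce
        have e: "(T \<union> T') \<inter> {..<h} = T" using a by fastforce
        have "(T \<union> T') - {..<h} = T'" using a by fastforce
        with split[OF sub] e a True show "card (T \<union> T') = n" by simp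
        show "T \<union> T' \<in> (\<lambda>T. card (T \<inter> {..<h})) -` {card T}" by (simp add: e)
      qed
    next
      fix y assume "y \<in> ?P \<times> ?R"
      then obtain T T' where y: "y = (T, T')" "T \<subseteq> {..<h}" "T' \<subseteq> {h..<s}" by auto
      have "(T \<union> T') \<inter> {..<h} = T" "(T \<union> T') - {..<h} = T'" using y by fastforce+
      thus "((\<lambda>(T, T'). T \<union> T') y \<inter> {..<h}, (\<lambda>(T, T'). T \<union> T') y - {..<h}) = y"
        using y by simp
    qed auto
    hence "card ?V = card ?P * card ?R"
      unfolding card_cartesian_product[symmetric] by (rule bij_betw_same_card)
    also have "\<dots> = (h choose k) * ((s - h) choose (n - k))" by (simp add: n_subsets)
    finally show ?thesis using * True by simp
  qed
qed

definition gen_sigma :: "'w measure \<Rightarrow> ('w \<Rightarrow> nat) set \<Rightarrow> 'w measure" where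
  "gen_sigma M \<Y> = sigma (space M) {Y -` S \<inter> space M | Y S. Y \<in> \<Y>}"

text \<open>
  In all sequences the entry with index 0 is unused. The subtraction of naturals in the
  definition of \<open>urn_K\<close> never truncates, up to a null set: the hypergeometric law
  assumed below forces \<open>X j \<le> N j\<close> almost surely.
\<close>

definition urn_H :: "nat \<Rightarrow> (nat \<Rightarrow> 'w \<Rightarrow> nat) \<Rightarrow> (nat \<Rightarrow> 'w \<Rightarrow> nat) \<Rightarrow> nat \<Rightarrow> 'w \<Rightarrow> nat" where
  "urn_H a X A n \<omega> = a + (\<Sum>j=1..n. A j \<omega> * X j \<omega>)"

definition urn_K ::
  "nat \<Rightarrow> (nat \<Rightarrow> 'w \<Rightarrow> nat) \<Rightarrow> (nat \<Rightarrow> 'w \<Rightarrow> nat) \<Rightarrow> (nat \<Rightarrow> 'w \<Rightarrow> nat) \<Rightarrow> nat \<Rightarrow> 'w \<Rightarrow> nat" where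
  "urn_K b N X B n \<omega> = b + (\<Sum>j=1..n. B j \<omega> * (N j \<omega> - X j \<omega>))"

definition urn_vars ::
  "(nat \<Rightarrow> 'w \<Rightarrow> nat) \<Rightarrow> (nat \<Rightarrow> 'w \<Rightarrow> nat) \<Rightarrow> (nat \<Rightarrow> 'w \<Rightarrow> nat) \<Rightarrow> (nat \<Rightarrow> 'w \<Rightarrow> nat)
    \<Rightarrow> nat \<Rightarrow> ('w \<Rightarrow> nat) set" where
  "urn_vars N X A B n = (\<Union>j\<in>{1..n}. {N j, X j, A j, B j})"

definition urn_F ::
  "'w measure \<Rightarrow> (nat \<Rightarrow> 'w \<Rightarrow> nat) \<Rightarrow> (nat \<Rightarrow> 'w \<Rightarrow> nat) \<Rightarrow> (nat \<Rightarrow> 'w \<Rightarrow> nat) \<Rightarrow> (nat \<Rightarrow> 'w \<Rightarrow> nat)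
    \<Rightarrow> nat \<Rightarrow> 'w measure" where
  "urn_F M N X A B n = gen_sigma M (urn_vars N X A B n)"

locale urn_model = prob_space M for M :: "'w measure" +
  fixes a b :: nat
    and N X A B :: "nat \<Rightarrow> 'w \<Rightarrow> nat"
  assumes init: "a \<ge> 1" "b \<ge> 1"
    and rv: "\<And>n. n \<ge> 1 \<Longrightarrow> N n \<in> measurable M (count_space UNIV)"
            "\<And>n. n \<ge> 1 \<Longrightarrow> X n \<in> measurable M (count_space UNIV)"
            "\<And>n. n \<ge> 1 \<Longrightarrow> A n \<in> measurable M (count_space UNIV)"
            "\<And>n. n \<ge> 1 \<Longrightarrow> B n \<in> measurable M (count_space UNIV)"
    and N_concentrated:
      "\<And>n. AE \<omega> in M.
         real_cond_exp M (urn_F M N X A B n)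
           (indicator {\<omega> \<in> space M. N (Suc n) \<omega> \<in> {1..urn_H a X A n \<omega> + urn_K b N X B n \<omega>}}) \<omega> = 1"
    and X_hypergeometric:
      "\<And>n k. AE \<omega> in M.
         real_cond_exp M (gen_sigma M (urn_vars N X A B n \<union> {N (Suc n)}))
           (indicator {\<omega> \<in> space M. X (Suc n) \<omega> = k}) \<omega>
         = pmf (hypergeometric_pmf (N (Suc n) \<omega>)
                  (urn_H a X A n \<omega> + urn_K b N X B n \<omega>) (urn_H a X A n \<omega>)) k"
    and AB_pos: "\<And>n. n \<ge> 1 \<Longrightarrow> AE \<omega> in M. A n \<omega> \<ge> 1 \<and> B n \<omega> \<ge> 1"
    and AB_indep:
      "\<And>n. indep_set (sets (gen_sigma M {A (Suc n), B (Suc n)}))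
              (sets (gen_sigma M (urn_vars N X A B n \<union> {N (Suc n), X (Suc n)})))"
    and bounded:
      "\<exists>C. \<forall>n\<ge>1. AE \<omega> in M. A n \<omega> \<le> C \<and> B n \<omega> \<le> C \<and> N n \<omega> \<le> C"

text \<open>The term with index 0 of the series is zero, since division by zero yields zero.\<close>

definition urn_case_greater ::
  "'w measure \<Rightarrow> (nat \<Rightarrow> 'w \<Rightarrow> nat) \<Rightarrow> (nat \<Rightarrow> 'w \<Rightarrow> nat) \<Rightarrow> real \<Rightarrow> real \<Rightarrow> bool" where
  "urn_case_greater M A B mA mB \<longleftrightarrow> mA > mB \<and>
     summable (\<lambda>n. \<bar>(\<integral>\<omega>. real (A (Suc n) \<omega>) \<partial>M) * mB - mA * (\<integral>\<omega>. real (B (Suc n) \<omega>) \<partial>M)\<bar> / real n)"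

definition urn_case_equal ::
  "'w measure \<Rightarrow> (nat \<Rightarrow> 'w \<Rightarrow> nat) \<Rightarrow> (nat \<Rightarrow> 'w \<Rightarrow> nat) \<Rightarrow> bool" where
  "urn_case_equal M A B \<longleftrightarrow>
     (\<forall>n\<ge>1. (\<integral>\<omega>. real (A n \<omega>) \<partial>M) = (\<integral>\<omega>. real (B n \<omega>) \<partial>M))"

end

theory Submission
  imports Defs
begin

text \<open>
  Everything follows from one strong law with random weights. Let \<open>D\<^sub>j\<close> be square integrable
  martingale differences whose conditional variances are at most \<open>c w\<^sub>j\<close>, where \<open>w\<^sub>j \<ge> 0\<close> is
  predictable, and put \<open>W\<^sub>n = w\<^sub>0 + \<dots> + w\<^sub>n\<close>. The martingale with increments
  \<open>D\<^sub>j / (1 + W\<^sub>j)\<close> is bounded in \<open>L\<^sup>2\<close>, because \<open>w\<^sub>j / (1 + W\<^sub>j)\<^sup>2\<close> is dominated by a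
  telescoping sum; hence it converges almost surely, and Kronecker's lemma gives
  \<open>(D\<^sub>0 + \<dots> + D\<^sub>n) / W\<^sub>n \<rightarrow> 0\<close> wherever \<open>W\<^sub>n \<rightarrow> \<infinity>\<close>.

  Taking for \<open>D\<^sub>j\<close> the product of a predictable weight \<open>v\<^sub>j\<close> with the deviation of \<open>Z\<^sub>j\<close> from its
  conditional mean, one obtains that the \<open>v\<close>-weighted averages of \<open>Z\<close> converge to the limit of the
  conditional means. With \<open>v = 1\<close> this is (i); with \<open>Z\<close> a function of \<open>A\<^sub>j\<close> and \<open>B\<^sub>j\<close> and \<open>v\<close> equal to
  \<open>X\<^sub>j\<close>, \<open>N\<^sub>j - X\<^sub>j\<close> or \<open>X\<^sub>j (N\<^sub>j - X\<^sub>j)\<close> it yields (ii), (iii) and (iv), once the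
  weights are known to have a divergent sum. By the conditional Borel--Cantelli lemma (the same strong
  law with \<open>w\<^sub>j\<close> the conditional mean) it suffices that the hypergeometric means diverge; as the
  urn grows at most linearly and always contains both colours, these are at least of order \<open>1 / j\<close>,
  respectively \<open>(N\<^sub>j - 1) / j\<close>.
\<close>

subsection \<open>Stolz--Cesaro and Kronecker\<close>

lemma stolz_cesaro:
  fixes a s :: "nat \<Rightarrow> 'a::real_normed_vector" and b :: "nat \<Rightarrow> real"
  assumes mono: "incseq b" and at_top: "filterlim b at_top sequentially"
    and diff: "\<And>n. a (Suc n) - a n = (b (Suc n) - b n) *\<^sub>R s n"
    and lim: "s \<longlonglongrightarrow> l"
  shows "(\<lambda>n. a n /\<^sub>R b n) \<longlonglongrightarrow> l"
proof (rule LIMSEQ_I)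
  fix e :: real assume "e > 0"
  then obtain m where m: "\<And>n. n \<ge> m \<Longrightarrow> norm (s n - l) \<le> e / 2"
    using LIMSEQ_D[OF lim, of "e / 2"] by (auto intro: less_imp_le)
  define d where "d n = a n - b n *\<^sub>R l" for n
  have growth: "norm (d n) \<le> norm (d m) + (b n - b m) * (e / 2)" if "m \<le> n" for n
    using that
  proof (induction n rule: dec_induct)
    case (step n)
    have "d (Suc n) = d n + (b (Suc n) - b n) *\<^sub>R (s n - l)"
      using diff[of n] by (simp add: d_def algebra_simps)
    also have "norm \<dots> \<le> norm (d n) + (b (Suc n) - b n) * norm (s n - l)"
      using incseq_SucD[OF mono, of n] by (intro norm_triangle_le) simp
    also have "\<dots> \<le> norm (d n) + (b (Suc n) - b n) * (e / 2)"
      using m[of n] step.hyps incseq_SucD[OF mono, of n] by (intro add_left_mono mult_left_mono) auto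
    finally show ?case using step.IH by (simp add: algebra_simps diff_divide_distrib)
  qed simp
  have "\<forall>\<^sub>F n in sequentially. max 0 (2 * norm (d m) / e - b m) < b n"
    using at_top unfolding filterlim_at_top_dense by blast
  hence "\<forall>\<^sub>F n in sequentially. m \<le> n \<and> max 0 (2 * norm (d m) / e - b m) < b n"
    by (intro eventually_conj eventually_ge_at_top)
  then obtain n0 where n0: "\<And>n. n \<ge> n0 \<Longrightarrow> m \<le> n \<and> max 0 (2 * norm (d m) / e - b m) < b n"
    unfolding eventually_sequentially by blast
  show "\<exists>n0. \<forall>n\<ge>n0. norm (a n /\<^sub>R b n - l) < e"
  proof (intro exI allI impI)
    fix n assume "n0 \<le> n"
    from n0[OF this] have n: "m \<le> n" "0 < b n" "2 * norm (d m) / e - b m < b n" by auto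
    have "norm (d m) + (b n - b m) * (e / 2) < e * b n"
      using n(3) \<open>e > 0\<close> by (simp add: field_simps)
    hence "norm (d n) < e * b n" using growth[OF n(1)] by linarith
    moreover have "a n /\<^sub>R b n - l = d n /\<^sub>R b n" using n(2) by (simp add: d_def algebra_simps)
    ultimately show "norm (a n /\<^sub>R b n - l) < e"
      using n(2) by (simp add: field_simps)
  qed
qed

lemma kronecker:
  fixes x :: "nat \<Rightarrow> 'a::real_normed_vector" and b :: "nat \<Rightarrow> real"
  assumes mono: "incseq b" and at_top: "filterlim b at_top sequentially"
    and pos: "\<And>n. 0 < b n" and summable: "summable (\<lambda>n. x n /\<^sub>R b n)"
  shows "(\<lambda>n. (\<Sum>j\<le>n. x j) /\<^sub>R b n) \<longlonglongrightarrow> 0"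
proof -
  define s where "s n = (\<Sum>j<n. x j /\<^sub>R b j)" for n
  obtain l where s_lim: "s \<longlonglongrightarrow> l"
    using summable by (auto simp: s_def[abs_def] summable_def sums_def)
  have b_nz: "b n \<noteq> 0" for n using pos[of n] by simp
  have "(\<lambda>n. (b n *\<^sub>R s n - (\<Sum>j<n. x j)) /\<^sub>R b n) \<longlonglongrightarrow> l"
  proof (rule stolz_cesaro[OF mono at_top _ LIMSEQ_Suc[OF s_lim]])
    show "(b (Suc n) *\<^sub>R s (Suc n) - (\<Sum>j<Suc n. x j)) - (b n *\<^sub>R s n - (\<Sum>j<n. x j))
        = (b (Suc n) - b n) *\<^sub>R s (Suc n)" for n
      using b_nz[of n] by (simp add: s_def algebra_simps)
  qed
  moreover have "(\<lambda>n. x n /\<^sub>R b n) \<longlonglongrightarrow> 0" by (rule summable_LIMSEQ_zero[OF summable])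
  ultimately have "(\<lambda>n. s n + x n /\<^sub>R b n - (b n *\<^sub>R s n - (\<Sum>j<n. x j)) /\<^sub>R b n) \<longlonglongrightarrow> l + 0 - l"
    by (intro tendsto_intros s_lim)
  thus ?thesis
    using b_nz by (simp add: lessThan_Suc_atMost[symmetric] algebra_simps)
qed

lemma not_summable_div_Suc_if_average_tendsto:
  fixes x :: "nat \<Rightarrow> real"
  assumes average: "(\<lambda>n. (\<Sum>j<n. x j) / real n) \<longlonglongrightarrow> l" and "l \<noteq> 0"
  shows "\<not> summable (\<lambda>n. x n / real (Suc n))"
proof
  assume "summable (\<lambda>n. x n / real (Suc n))"
  hence "summable (\<lambda>n. x n /\<^sub>R real (Suc n))" by (simp add: divide_inverse_commute)
  hence "(\<lambda>n. (\<Sum>j\<le>n. x j) /\<^sub>R real (Suc n)) \<longlonglongrightarrow> 0"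
    by (intro kronecker filterlim_compose[OF filterlim_real_sequentially filterlim_Suc])
       (auto simp: incseq_def)
  moreover have "(\<lambda>n. (\<Sum>j\<le>n. x j) /\<^sub>R real (Suc n)) \<longlonglongrightarrow> l"
    using LIMSEQ_Suc[OF average]
    by (simp add: lessThan_Suc_atMost divide_inverse_commute del: of_nat_Suc)
  ultimately show False using LIMSEQ_unique \<open>l \<noteq> 0\<close> by blast
qed

lemma not_summable_one_div_Suc: "\<not> summable (\<lambda>n. 1 / real (Suc n))"
  using not_summable_harmonic[where 'a = real]
  by (simp add: summable_Suc_iff[of "\<lambda>n. 1 / real n"] inverse_eq_divide del: of_nat_Suc)

lemma sum_at_top_if_not_summable:
  fixes y :: "nat \<Rightarrow> real"
  assumes nonneg: "\<And>n. 0 \<le> y n" and "\<not> summable y"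
  shows "filterlim (\<lambda>n. \<Sum>j<n. y j) at_top sequentially"
  unfolding filterlim_at_top
proof
  fix Z
  obtain m where "Z < (\<Sum>j<m. y j)"
    using summableI_nonneg_bounded[of y Z] nonneg \<open>\<not> summable y\<close> by (meson not_le)
  moreover have "(\<Sum>j<m. y j) \<le> (\<Sum>j<n. y j)" if "m \<le> n" for n
    using that nonneg by (intro sum_mono2) auto
  ultimately show "\<forall>\<^sub>F n in sequentially. Z \<le> (\<Sum>j<n. y j)"
    unfolding eventually_sequentially by (meson less_imp_le order_trans)
qed

lemma sum_div_sum_tendsto_0:
  fixes w x :: "nat \<Rightarrow> real"
  assumes nonneg: "\<And>n. 0 \<le> w n"
    and at_top: "filterlim (\<lambda>n. \<Sum>j<n. w j) at_top sequentially"
    and summable: "summable (\<lambda>n. x n / (1 + (\<Sum>j\<le>n. w j)))"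
  shows "(\<lambda>n. (\<Sum>j<n. x j) / (\<Sum>j<n. w j)) \<longlonglongrightarrow> 0"
proof -
  let ?W = "\<lambda>n. \<Sum>j\<le>n. w j"
  have W_at_top: "filterlim ?W at_top sequentially"
    using filterlim_compose[OF at_top filterlim_Suc] by (simp only: lessThan_Suc_atMost)
  have "(\<lambda>n. (\<Sum>j\<le>n. x j) /\<^sub>R (1 + ?W n)) \<longlonglongrightarrow> 0"
  proof (rule kronecker)
    show "incseq (\<lambda>n. 1 + ?W n)" using nonneg by (intro incseq_SucI) simp
    show "filterlim (\<lambda>n. 1 + ?W n) at_top sequentially"
      by (rule filterlim_tendsto_add_at_top[OF tendsto_const W_at_top])
    show "0 < 1 + ?W n" for n using nonneg by (simp add: add_pos_nonneg sum_nonneg)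
  qed (use summable in \<open>simp add: divide_inverse_commute\<close>)
  moreover have "(\<lambda>n. 1 / ?W n + 1) \<longlonglongrightarrow> 0 + 1"
    by (intro tendsto_intros tendsto_divide_0[OF tendsto_const]
          filterlim_at_top_imp_at_infinity[OF W_at_top])
  ultimately have "(\<lambda>n. ((\<Sum>j\<le>n. x j) /\<^sub>R (1 + ?W n)) * (1 / ?W n + 1)) \<longlonglongrightarrow> 0 * (0 + 1)"
    by (rule tendsto_mult)
  moreover have "\<forall>\<^sub>F n in sequentially. 0 < ?W n"
    using W_at_top by (simp add: filterlim_at_top_dense)
  hence "\<forall>\<^sub>F n in sequentially. ((\<Sum>j\<le>n. x j) /\<^sub>R (1 + ?W n)) * (1 / ?W n + 1) = (\<Sum>j\<le>n. x j) / ?W n"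
  proof eventually_elim
    case (elim n)
    hence "1 / ?W n + 1 = (1 + ?W n) / ?W n" by (simp add: field_simps)
    thus ?case using elim by simp
  qed
  ultimately have "(\<lambda>n. (\<Sum>j\<le>n. x j) / ?W n) \<longlonglongrightarrow> 0 * (0 + 1)"
    by (rule Lim_transform_eventually)
  thus ?thesis
    using LIMSEQ_imp_Suc by (simp add: lessThan_Suc_atMost[symmetric] del: sum.lessThan_Suc)
qed

lemma filterlim_at_top_if_relative_diff_tendsto_0:
  fixes f g :: "'a \<Rightarrow> real"
  assumes at_top: "filterlim g at_top F" and lim: "((\<lambda>x. (f x - g x) / g x) \<longlongrightarrow> 0) F"
  shows "filterlim f at_top F"
proof -
  have "((\<lambda>x. 1 + (f x - g x) / g x) \<longlongrightarrow> 1 + 0) F" by (intro tendsto_intros lim)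
  from filterlim_tendsto_pos_mult_at_top[OF this _ at_top]
  have "filterlim (\<lambda>x. (1 + (f x - g x) / g x) * g x) at_top F" by simp
  moreover have "\<forall>\<^sub>F x in F. 0 < g x" using at_top by (simp add: filterlim_at_top_dense)
  hence "\<forall>\<^sub>F x in F. (1 + (f x - g x) / g x) * g x = f x"
    by eventually_elim (simp add: field_simps)
  ultimately show ?thesis by (rule filterlim_cong[OF refl refl, THEN iffD1, rotated])
qed

lemma sum_weight_div_square_le_1:
  fixes w :: "nat \<Rightarrow> real"
  assumes nonneg: "\<And>n. 0 \<le> w n"
  shows "(\<Sum>j<n. w j / (1 + (\<Sum>i\<le>j. w i))\<^sup>2) \<le> 1"
proof -
  let ?V = "\<lambda>n. 1 + (\<Sum>i<n. w i)"
  have V_ge: "1 \<le> ?V n" for n by (simp add: sum_nonneg nonneg)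
  have "w j / (1 + (\<Sum>i\<le>j. w i))\<^sup>2 \<le> 1 / ?V j - 1 / ?V (Suc j)" for j
  proof -
    have "w j / (?V j + w j)\<^sup>2 \<le> w j / (?V j * (?V j + w j))"
      unfolding power2_eq_square using V_ge[of j] nonneg[of j]
      by (intro divide_left_mono mult_right_mono mult_pos_pos) auto
    also have "\<dots> = 1 / ?V j - 1 / (?V j + w j)" using V_ge[of j] nonneg[of j] by (simp add: field_simps)
    finally show ?thesis by (simp add: lessThan_Suc_atMost[symmetric] add.assoc)
  qed
  hence "(\<Sum>j<n. w j / (1 + (\<Sum>i\<le>j. w i))\<^sup>2) \<le> (\<Sum>j<n. 1 / ?V j - 1 / ?V (Suc j))" by (rule sum_mono)
  also have "\<dots> = 1 - 1 / ?V n" by (subst sum_lessThan_telescope') simp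
  also have "\<dots> \<le> 1" using V_ge[of n] by simp
  finally show ?thesis .
qed

lemma stopped_sum_ge:
  fixes d :: "nat \<Rightarrow> 'a::real_normed_vector"
  assumes "i \<le> n" "e \<le> norm (\<Sum>j<i. d j)"
  shows "e \<le> norm (\<Sum>j<n. if \<forall>i\<le>j. norm (\<Sum>l<i. d l) < e then d j else 0)"
proof -
  define \<tau> where "\<tau> = (LEAST i. e \<le> norm (\<Sum>j<i. d j))"
  have \<tau>: "e \<le> norm (\<Sum>j<\<tau>. d j)" "\<tau> \<le> i"
    unfolding \<tau>_def using assms(2) by (rule LeastI[of "\<lambda>i. e \<le> norm (\<Sum>j<i. d j)"], rule Least_le)
  have before_\<tau>: "(\<forall>i\<le>j. norm (\<Sum>l<i. d l) < e) \<longleftrightarrow> j < \<tau>" for j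
    using \<tau>(1) not_less_Least[of _ "\<lambda>i. e \<le> norm (\<Sum>j<i. d j)", folded \<tau>_def]
    by (meson le_less_trans not_le)
  have "(\<Sum>j<n. if j < \<tau> then d j else 0) = (\<Sum>j<\<tau>. d j)"
    using \<tau>(2) assms(1) by (intro sum.mono_neutral_cong_right) auto
  thus ?thesis using \<tau>(1) by (simp add: before_\<tau>)
qed

lemma summable_if_tails_small:
  fixes d :: "nat \<Rightarrow> 'a::banach"
  assumes "\<And>e. e > 0 \<Longrightarrow> \<exists>k. \<forall>n. norm (\<Sum>j<n. d (j + k)) < e"
  shows "summable d"
  unfolding summable_Cauchy
proof (intro allI impI)
  fix e :: real assume "e > 0"
  then obtain k where k: "norm (\<Sum>j<n. d (j + k)) < e / 2" for n using assms[of "e / 2"] by auto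
  have "norm (sum d {m..<n}) < e" if "m \<ge> k" for m n
  proof (cases "m \<le> n")
    case True
    have "sum d {k..<m} + sum d {m..<n} = sum d {k..<n}"
      using that True by (intro sum.atLeastLessThan_concat)
    moreover have "sum d {k..<i} = (\<Sum>j<i - k. d (j + k))" if "k \<le> i" for i
      using that sum.shift_bounds_nat_ivl[of d 0 k "i - k"] by (simp add: atLeast0LessThan)
    ultimately have "sum d {m..<n} = (\<Sum>j<n - k. d (j + k)) - (\<Sum>j<m - k. d (j + k))"
      using that True by (simp add: algebra_simps)
    also have "norm \<dots> < e / 2 + e / 2"
      by (rule le_less_trans[OF norm_triangle_ineq4 add_strict_mono]) (rule k)+
    finally show ?thesis by simp
  qed (use \<open>e > 0\<close> in simp)
  thus "\<exists>k. \<forall>m\<ge>k. \<forall>n. norm (sum d {m..<n}) < e" by blast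
qed

subsection \<open>Almost sure convergence of square integrable martingales\<close>

lemma integrable_mult_if_square_integrable:
  fixes f g :: "'a \<Rightarrow> real"
  assumes [measurable]: "f \<in> borel_measurable M" "g \<in> borel_measurable M"
    and "integrable M (\<lambda>x. (f x)\<^sup>2)" "integrable M (\<lambda>x. (g x)\<^sup>2)"
  shows "integrable M (\<lambda>x. f x * g x)"
proof (rule Bochner_Integration.integrable_bound)
  show "integrable M (\<lambda>x. (f x)\<^sup>2 + (g x)\<^sup>2)" using assms by simp
  have "\<bar>a * b\<bar> \<le> a\<^sup>2 + b\<^sup>2" for a b :: real
    using sum_squares_bound[of "\<bar>a\<bar>" "\<bar>b\<bar>"] abs_ge_zero[of "a * b"]
    unfolding abs_mult power2_abs by linarith
  thus "AE x in M. norm (f x * g x) \<le> norm ((f x)\<^sup>2 + (g x)\<^sup>2)" by simp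
qed measurable

locale filtered_prob_space = prob_space M + filtration "space M" G
  for M :: "'a measure" and G :: "nat \<Rightarrow> 'a measure" +
  assumes sets_G_subset: "\<And>n. sets (G n) \<subseteq> sets M"
begin

sublocale cond: finite_measure_subalgebra M "G n" for n
  by unfold_locales (simp add: subalgebra_def space_F sets_G_subset)

lemma measurable_G_mono: "f \<in> measurable (G m) L \<Longrightarrow> m \<le> n \<Longrightarrow> f \<in> measurable (G n) L"
  using sets_F_mono[of m n] by (auto simp: measurable_def space_F)

lemma measurable_G_imp_measurable: "f \<in> measurable (G n) L \<Longrightarrow> f \<in> measurable M L"
  by (rule measurable_from_subalg[OF cond.subalg])

end

locale square_integrable_martingale_differences = filtered_prob_space M G
  for M :: "'a measure" and G :: "nat \<Rightarrow> 'a measure" +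
  fixes D :: "nat \<Rightarrow> 'a \<Rightarrow> real"
  assumes adapted: "\<And>n. D n \<in> borel_measurable (G (Suc n))"
    and square_integrable: "\<And>n. integrable M (\<lambda>x. (D n x)\<^sup>2)"
    and centred: "\<And>n. AE x in M. real_cond_exp M (G n) (D n) x = 0"
begin

lemma D_measurable [measurable]: "D n \<in> borel_measurable M"
  using adapted measurable_G_imp_measurable by blast

lemma integral_mult_D_eq_0:
  assumes U: "U \<in> borel_measurable (G n)" and "integrable M (\<lambda>x. (U x)\<^sup>2)"
  shows "(\<integral>x. U x * D n x \<partial>M) = 0"
proof -
  have [measurable]: "U \<in> borel_measurable M" using measurable_G_imp_measurable[OF U] .
  have "integrable M (\<lambda>x. U x * D n x)"
    using assms(2) square_integrable by (intro integrable_mult_if_square_integrable) auto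
  hence "(\<integral>x. U x * D n x \<partial>M) = (\<integral>x. U x * real_cond_exp M (G n) (D n) x \<partial>M)"
    using U by (intro cond.real_cond_exp_intg(2)[symmetric]) auto
  also have "\<dots> = (\<integral>x. 0 \<partial>M)"
    using centred[of n] by (intro integral_cong_AE) auto
  finally show ?thesis by simp
qed

lemma partial_sum_adapted: "(\<lambda>x. \<Sum>j<n. D j x) \<in> borel_measurable (G n)"
  by (intro borel_measurable_sum measurable_G_mono[OF adapted]) simp

lemma partial_sum_square_integrable: "integrable M (\<lambda>x. (\<Sum>j<n. D j x)\<^sup>2)"
proof (induction n)
  case (Suc n)
  have "integrable M (\<lambda>x. (\<Sum>j<n. D j x) * D n x)"
    using Suc square_integrable by (intro integrable_mult_if_square_integrable) auto
  thus ?case using Suc square_integrable[of n] by (simp add: power2_sum mult.assoc)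
qed simp

lemma second_moment_partial_sum: "(\<integral>x. (\<Sum>j<n. D j x)\<^sup>2 \<partial>M) = (\<Sum>j<n. \<integral>x. (D j x)\<^sup>2 \<partial>M)"
proof (induction n)
  case (Suc n)
  have "integrable M (\<lambda>x. (\<Sum>j<n. D j x) * D n x)"
    using partial_sum_square_integrable square_integrable
    by (intro integrable_mult_if_square_integrable) auto
  moreover have "(\<integral>x. (\<Sum>j<n. D j x) * D n x \<partial>M) = 0"
    by (rule integral_mult_D_eq_0[OF partial_sum_adapted partial_sum_square_integrable])
  ultimately show ?case
    using Suc partial_sum_square_integrable[of n] square_integrable[of n]
    by (simp add: power2_sum mult.assoc)
qed simp

lemma predictable_transform:
  assumes U: "\<And>n. U n \<in> borel_measurable (G n)" and bound: "\<And>n. AE x in M. \<bar>U n x\<bar> \<le> c"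
  shows "square_integrable_martingale_differences M G (\<lambda>n x. U n x * D n x)"
proof
  fix n
  have [measurable]: "U n \<in> borel_measurable M" using measurable_G_imp_measurable[OF U] .
  show "(\<lambda>x. U n x * D n x) \<in> borel_measurable (G (Suc n))"
    by (intro borel_measurable_times adapted measurable_G_mono[OF U]) simp
  show square: "integrable M (\<lambda>x. (U n x * D n x)\<^sup>2)"
  proof (rule Bochner_Integration.integrable_bound)
    show "integrable M (\<lambda>x. c\<^sup>2 * (D n x)\<^sup>2)" using square_integrable by simp
    show "AE x in M. norm ((U n x * D n x)\<^sup>2) \<le> norm (c\<^sup>2 * (D n x)\<^sup>2)"
      using bound[of n]
    proof eventually_elim
      case (elim x)
      hence "(U n x)\<^sup>2 \<le> c\<^sup>2" by (metis abs_ge_zero power2_abs power_mono)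
      thus ?case by (simp add: power_mult_distrib mult_right_mono)
    qed
  qed measurable
  have "integrable M (\<lambda>x. U n x * D n x)"
    by (rule square_integrable_imp_integrable[OF _ square]) measurable
  from cond.real_cond_exp_mult[OF U D_measurable this] centred[of n]
  show "AE x in M. real_cond_exp M (G n) (\<lambda>x. U n x * D n x) x = 0"
    by eventually_elim simp
qed

text \<open>The martingale is stopped on reaching the level \<open>e\<close>, so that its terminal value is at least \<open>e\<close>
  in absolute value whenever this level is reached.\<close>

lemma maximal_inequality:
  assumes "e > 0"
  shows "prob {x \<in> space M. \<exists>i\<le>n. e \<le> \<bar>\<Sum>j<i. D j x\<bar>} \<le> (\<Sum>j<n. \<integral>x. (D j x)\<^sup>2 \<partial>M) / e\<^sup>2"
proof -
  define U where "U j x = (if \<forall>i\<le>j. \<bar>\<Sum>l<i. D l x\<bar> < e then 1 else 0 :: real)" for j x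
  have U_predictable: "U j \<in> borel_measurable (G j)" for j
  proof -
    have "Measurable.pred (G j) (\<lambda>x. \<forall>i\<in>{..j}. \<bar>\<Sum>l<i. D l x\<bar> < e)"
      by (intro pred_intros_finite borel_measurable_pred_less borel_measurable_abs
            borel_measurable_const measurable_G_mono[OF partial_sum_adapted]) auto
    thus ?thesis unfolding U_def by (simp add: atMost_iff[symmetric] Ball_def[symmetric] del: atMost_iff)
  qed
  interpret stopped: square_integrable_martingale_differences M G "\<lambda>j x. U j x * D j x"
    by (rule predictable_transform[OF U_predictable, of 1]) (simp add: U_def)
  define T where "T x = (\<Sum>j<n. U j x * D j x)" for x
  have [measurable]: "T \<in> borel_measurable M" unfolding T_def by measurable
  have "e\<^sup>2 \<le> (T x)\<^sup>2" if "i \<le> n" "e \<le> \<bar>\<Sum>j<i. D j x\<bar>" for i x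
  proof -
    have "T x = (\<Sum>j<n. if \<forall>i\<le>j. \<bar>\<Sum>l<i. D l x\<bar> < e then D j x else 0)"
      unfolding T_def U_def by (intro sum.cong) auto
    hence "e \<le> \<bar>T x\<bar>" using stopped_sum_ge[of i n e "\<lambda>j. D j x"] that by simp
    thus ?thesis using \<open>e > 0\<close> by (metis abs_le_square_iff abs_of_pos)
  qed
  hence "prob {x \<in> space M. \<exists>i\<le>n. e \<le> \<bar>\<Sum>j<i. D j x\<bar>} \<le> prob {x \<in> space M. (T x)\<^sup>2 \<ge> e\<^sup>2}"
    by (intro finite_measure_mono) auto
  also have "\<dots> \<le> (\<integral>x. (T x)\<^sup>2 \<partial>M) / e\<^sup>2"
    using stopped.partial_sum_square_integrable \<open>e > 0\<close>
    by (intro integral_Markov_inequality_measure[where A = "{}"]) (auto simp: T_def)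
  also have "\<dots> = (\<Sum>j<n. \<integral>x. (U j x * D j x)\<^sup>2 \<partial>M) / e\<^sup>2"
    unfolding T_def by (simp only: stopped.second_moment_partial_sum)
  also have "\<dots> \<le> (\<Sum>j<n. \<integral>x. (D j x)\<^sup>2 \<partial>M) / e\<^sup>2"
    using stopped.square_integrable square_integrable
    by (intro divide_right_mono sum_mono integral_mono) (auto simp: U_def)
  finally show ?thesis .
qed

lemma maximal_inequality_infinite:
  assumes "e > 0" and summable: "summable (\<lambda>j. \<integral>x. (D j x)\<^sup>2 \<partial>M)"
  shows "prob {x \<in> space M. \<exists>i. e \<le> \<bar>\<Sum>j<i. D j x\<bar>} \<le> (\<Sum>j. \<integral>x. (D j x)\<^sup>2 \<partial>M) / e\<^sup>2"
proof -
  define E where "E n = {x \<in> space M. \<exists>i\<le>n. e \<le> \<bar>\<Sum>j<i. D j x\<bar>}" for n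
  have "(\<lambda>n. prob (E n)) \<longlonglongrightarrow> prob (\<Union>n. E n)"
    by (rule finite_Lim_measure_incseq) (auto simp: E_def incseq_def intro: order_trans)
  moreover have "prob (E n) \<le> (\<Sum>j. \<integral>x. (D j x)\<^sup>2 \<partial>M) / e\<^sup>2" for n
  proof -
    have "(\<Sum>j<n. \<integral>x. (D j x)\<^sup>2 \<partial>M) \<le> (\<Sum>j. \<integral>x. (D j x)\<^sup>2 \<partial>M)"
      by (rule sum_le_suminf[OF summable]) auto
    thus ?thesis
      using maximal_inequality[OF \<open>e > 0\<close>, of n] unfolding E_def
      by (meson divide_right_mono order_trans zero_le_power2)
  qed
  ultimately have "prob (\<Union>n. E n) \<le> (\<Sum>j. \<integral>x. (D j x)\<^sup>2 \<partial>M) / e\<^sup>2"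
    by (intro LIMSEQ_le_const2) auto
  moreover have "(\<Union>n. E n) = {x \<in> space M. \<exists>i. e \<le> \<bar>\<Sum>j<i. D j x\<bar>}"
    unfolding E_def by auto
  ultimately show ?thesis by simp
qed

lemma shifted: "square_integrable_martingale_differences M (\<lambda>n. G (n + k)) (\<lambda>n. D (n + k))"
  by unfold_locales
     (use adapted square_integrable centred sets_G_subset sets_F_mono in \<open>auto simp: space_F\<close>)

lemma AE_ex_tail_small:
  assumes "e > 0" and summable: "summable (\<lambda>j. \<integral>x. (D j x)\<^sup>2 \<partial>M)"
  shows "AE x in M. \<exists>k. \<forall>n. \<bar>\<Sum>j<n. D (j + k) x\<bar> < e"
proof -
  define E where "E k = {x \<in> space M. \<exists>n. e \<le> \<bar>\<Sum>j<n. D (j + k) x\<bar>}" for k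
  define r where "r k = (\<Sum>j. \<integral>x. (D (j + k) x)\<^sup>2 \<partial>M) / e\<^sup>2" for k
  have "prob (\<Inter>k. E k) \<le> prob (E k)" for k by (intro finite_measure_mono) (auto simp: E_def)
  also have "prob (E k) \<le> r k" for k
    unfolding E_def r_def
    using square_integrable_martingale_differences.maximal_inequality_infinite[OF shifted[of k] \<open>e > 0\<close>]
      summable_ignore_initial_segment[OF summable, of k] by simp
  finally have "prob (\<Inter>k. E k) \<le> r k" for k .
  moreover have "r \<longlonglongrightarrow> 0 / e\<^sup>2"
    unfolding r_def using \<open>e > 0\<close> by (intro tendsto_intros suminf_exist_split2 summable) simp
  ultimately have "prob (\<Inter>k. E k) \<le> 0 / e\<^sup>2" by (intro LIMSEQ_le_const) auto
  hence "prob (\<Inter>k. E k) = 0" by (simp add: measure_le_0_iff)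
  hence "AE x in M. x \<notin> (\<Inter>k. E k)" by (subst (asm) prob_eq_0) (auto simp: E_def)
  thus ?thesis using AE_space by eventually_elim (auto simp: E_def not_le)
qed

theorem AE_summable:
  assumes summable: "summable (\<lambda>j. \<integral>x. (D j x)\<^sup>2 \<partial>M)"
  shows "AE x in M. summable (\<lambda>j. D j x)"
proof -
  have "AE x in M. \<forall>i::nat. \<exists>k. \<forall>n. \<bar>\<Sum>j<n. D (j + k) x\<bar> < inverse (Suc i)"
    using AE_ex_tail_small[OF _ summable] by (simp add: AE_all_countable)
  thus ?thesis
  proof eventually_elim
    case (elim x)
    show ?case
    proof (rule summable_if_tails_small)
      fix e :: real assume "e > 0"
      then obtain i where "inverse (real (Suc i)) < e" using reals_Archimedean by blast
      moreover obtain k where "\<And>n. \<bar>\<Sum>j<n. D (j + k) x\<bar> < inverse (real (Suc i))" using elim by blast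
      ultimately have "norm (\<Sum>j<n. D (j + k) x) < e" for n by (metis less_trans real_norm_def)
      thus "\<exists>k. \<forall>n. norm (\<Sum>j<n. D (j + k) x) < e" by blast
    qed
  qed
qed

end

subsection \<open>Strong laws with random weights\<close>

lemma (in prob_space)
  fixes w :: "nat \<Rightarrow> 'a \<Rightarrow> real"
  assumes [measurable]: "\<And>n. w n \<in> borel_measurable M" and nonneg: "AE x in M. \<forall>n. 0 \<le> w n x"
  shows integrable_weight_div_square: "integrable M (\<lambda>x. w n x / (1 + (\<Sum>j\<le>n. w j x))\<^sup>2)"
    and sum_integral_weight_div_square_le_1:
      "(\<Sum>j<n. \<integral>x. w j x / (1 + (\<Sum>i\<le>j. w i x))\<^sup>2 \<partial>M) \<le> 1"
proof -
  let ?q = "\<lambda>n x. w n x / (1 + (\<Sum>j\<le>n. w j x))\<^sup>2"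
  have sum_le_1: "AE x in M. (\<Sum>j<n. ?q j x) \<le> 1" for n
    using nonneg
  proof eventually_elim
    case (elim x)
    thus ?case using sum_weight_div_square_le_1[of "\<lambda>j. w j x" n] by simp
  qed
  show integrable: "integrable M (?q n)" for n
  proof (rule integrable_const_bound)
    show "AE x in M. norm (?q n x) \<le> 1"
      using nonneg sum_le_1[of "Suc n"]
    proof eventually_elim
      case (elim x)
      hence "0 \<le> (\<Sum>j<n. ?q j x)" by (intro sum_nonneg) simp
      thus ?case using elim by simp
    qed
  qed measurable
  have "(\<Sum>j<n. \<integral>x. ?q j x \<partial>M) = (\<integral>x. (\<Sum>j<n. ?q j x) \<partial>M)" using integrable by simp
  also have "\<dots> \<le> 1" using integrable sum_le_1 by (intro integral_le_const) auto
  finally show "(\<Sum>j<n. \<integral>x. ?q j x \<partial>M) \<le> 1" .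
qed

context square_integrable_martingale_differences
begin

lemma second_moment_transform_le:
  assumes U: "U \<in> borel_measurable (G n)" and bound: "AE x in M. \<bar>U x\<bar> \<le> k"
    and cond_variance: "AE x in M. real_cond_exp M (G n) (\<lambda>x. (D n x)\<^sup>2) x \<le> c * w x"
    and integrable: "integrable M (\<lambda>x. (U x)\<^sup>2 * w x)"
  shows "(\<integral>x. (U x * D n x)\<^sup>2 \<partial>M) \<le> c * (\<integral>x. (U x)\<^sup>2 * w x \<partial>M)"
proof -
  have [measurable]: "(\<lambda>x. (U x)\<^sup>2) \<in> borel_measurable (G n)" using U by measurable
  have [measurable]: "U \<in> borel_measurable M" using measurable_G_imp_measurable[OF U] .
  have product: "integrable M (\<lambda>x. (U x)\<^sup>2 * (D n x)\<^sup>2)"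
  proof (rule Bochner_Integration.integrable_bound)
    show "integrable M (\<lambda>x. k\<^sup>2 * (D n x)\<^sup>2)" using square_integrable by simp
    show "AE x in M. norm ((U x)\<^sup>2 * (D n x)\<^sup>2) \<le> norm (k\<^sup>2 * (D n x)\<^sup>2)"
      using bound by eventually_elim (simp add: abs_le_square_iff[symmetric] mult_right_mono)
  qed measurable
  have "(\<integral>x. (U x * D n x)\<^sup>2 \<partial>M) = (\<integral>x. (U x)\<^sup>2 * real_cond_exp M (G n) (\<lambda>x. (D n x)\<^sup>2) x \<partial>M)"
    using cond.real_cond_exp_intg(2)[OF product] by (simp add: power_mult_distrib)
  also have "\<dots> \<le> (\<integral>x. c * ((U x)\<^sup>2 * w x) \<partial>M)"
  proof (rule integral_mono_AE)
    show "AE x in M. (U x)\<^sup>2 * real_cond_exp M (G n) (\<lambda>x. (D n x)\<^sup>2) x \<le> c * ((U x)\<^sup>2 * w x)"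
      using cond_variance
    proof eventually_elim
      case (elim x)
      from mult_left_mono[OF this zero_le_power2[of "U x"]] show ?case by (simp add: mult.left_commute)
    qed
  qed (use cond.real_cond_exp_intg(1)[OF product] integrable in auto)
  finally show ?thesis by simp
qed

lemma AE_summable_div_weights:
  assumes w_predictable: "\<And>n. w n \<in> borel_measurable (G n)"
    and w_nonneg: "AE x in M. \<forall>n. 0 \<le> w n x" and "0 \<le> c"
    and cond_variance: "\<And>n. AE x in M. real_cond_exp M (G n) (\<lambda>x. (D n x)\<^sup>2) x \<le> c * w n x"
  shows "AE x in M. summable (\<lambda>n. D n x / (1 + (\<Sum>j\<le>n. w j x)))"
proof -
  define U where "U n x = 1 / (1 + (\<Sum>j\<le>n. w j x))" for n x
  have U_predictable: "U n \<in> borel_measurable (G n)" for n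
    unfolding U_def
    by (intro borel_measurable_divide borel_measurable_add borel_measurable_sum borel_measurable_const)
       (auto intro: measurable_G_mono[OF w_predictable])
  have [measurable]: "w n \<in> borel_measurable M" for n
    using w_predictable measurable_G_imp_measurable by blast
  have U_le_1: "AE x in M. \<bar>U n x\<bar> \<le> 1" for n
    using w_nonneg
  proof eventually_elim
    case (elim x)
    hence "0 \<le> (\<Sum>j\<le>n. w j x)" by (simp add: sum_nonneg)
    thus ?case by (simp add: U_def)
  qed
  interpret normalised: square_integrable_martingale_differences M G "\<lambda>n x. U n x * D n x"
    by (rule predictable_transform[OF U_predictable U_le_1])
  have U_square: "(U n x)\<^sup>2 * w n x = w n x / (1 + (\<Sum>j\<le>n. w j x))\<^sup>2" for n x
    by (simp add: U_def power_divide)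
  have "(\<Sum>j<n. \<integral>x. (U j x * D j x)\<^sup>2 \<partial>M) \<le> c" for n
  proof -
    have "(\<Sum>j<n. \<integral>x. (U j x * D j x)\<^sup>2 \<partial>M) \<le> (\<Sum>j<n. c * (\<integral>x. (U j x)\<^sup>2 * w j x \<partial>M))"
      by (intro sum_mono second_moment_transform_le[OF U_predictable U_le_1 cond_variance])
         (simp add: U_square integrable_weight_div_square w_nonneg)
    also have "\<dots> \<le> c * 1"
      unfolding U_square sum_distrib_left[symmetric] using \<open>0 \<le> c\<close>
      by (intro mult_left_mono sum_integral_weight_div_square_le_1 w_nonneg) auto
    finally show ?thesis by simp
  qed
  hence "summable (\<lambda>j. \<integral>x. (U j x * D j x)\<^sup>2 \<partial>M)" by (intro summableI_nonneg_bounded) auto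
  from normalised.AE_summable[OF this] show ?thesis by (simp add: U_def)
qed

theorem AE_sum_div_weights_tendsto_0:
  assumes w_predictable: "\<And>n. w n \<in> borel_measurable (G n)"
    and w_nonneg: "AE x in M. \<forall>n. 0 \<le> w n x" and "0 \<le> c"
    and cond_variance: "\<And>n. AE x in M. real_cond_exp M (G n) (\<lambda>x. (D n x)\<^sup>2) x \<le> c * w n x"
  shows "AE x in M. filterlim (\<lambda>n. \<Sum>j<n. w j x) at_top sequentially \<longrightarrow>
           (\<lambda>n. (\<Sum>j<n. D j x) / (\<Sum>j<n. w j x)) \<longlonglongrightarrow> 0"
  using AE_summable_div_weights[OF assms] w_nonneg by eventually_elim (auto intro: sum_div_sum_tendsto_0)

end

lemma (in finite_measure) integrable_power2_if_AE_abs_le: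
  fixes f :: "'a \<Rightarrow> real"
  assumes [measurable]: "f \<in> borel_measurable M" and bound: "AE x in M. \<bar>f x\<bar> \<le> c"
  shows "integrable M (\<lambda>x. (f x)\<^sup>2)"
proof (rule integrable_const_bound)
  show "AE x in M. norm ((f x)\<^sup>2) \<le> c\<^sup>2"
    using bound
  proof eventually_elim
    case (elim x)
    thus ?case using power_mono[OF elim, of 2] by simp
  qed
qed measurable

lemma (in finite_measure_subalgebra) AE_abs_real_cond_exp_le:
  assumes "f \<in> borel_measurable M" and bound: "AE x in M. \<bar>f x\<bar> \<le> c"
  shows "AE x in M. \<bar>real_cond_exp M F f x\<bar> \<le> c"
proof -
  have f: "integrable M f" using assms by (intro integrable_const_bound[of _ c]) auto
  have "AE x in M. f x \<le> c" "AE x in M. - c \<le> f x" using bound by (auto elim: eventually_mono)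
  from real_cond_exp_le_c[OF f this(1)] real_cond_exp_ge_c[OF f this(2)] show ?thesis
    by eventually_elim simp
qed

context filtered_prob_space
begin

lemma square_integrable_martingale_differences_diff_cond_exp:
  assumes adapted: "\<And>n. Y n \<in> borel_measurable (G (Suc n))"
    and square: "\<And>n. integrable M (\<lambda>x. (Y n x)\<^sup>2)"
  shows "square_integrable_martingale_differences M G (\<lambda>n x. Y n x - real_cond_exp M (G n) (Y n) x)"
proof
  fix n
  let ?E = "real_cond_exp M (G n) (Y n)"
  have [measurable]: "Y n \<in> borel_measurable M" using adapted measurable_G_imp_measurable by blast
  have Y: "integrable M (Y n)" by (rule square_integrable_imp_integrable[OF _ square]) measurable
  have E: "integrable M ?E" by (rule cond.real_cond_exp_int(1)[OF Y])
  have "integrable M (\<lambda>x. (?E x)\<^sup>2)"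
    using square[of n]
    by (intro cond.integrable_convex_cond_exp[OF Y, of UNIV]) (auto simp: convex_power2)
  moreover from this have "integrable M (\<lambda>x. Y n x * ?E x)"
    using square[of n] by (intro integrable_mult_if_square_integrable) auto
  ultimately show "integrable M (\<lambda>x. (Y n x - ?E x)\<^sup>2)"
    using square[of n] by (simp add: power2_diff mult.assoc)
  show "(\<lambda>x. Y n x - ?E x) \<in> borel_measurable (G (Suc n))"
    using adapted by (intro borel_measurable_diff measurable_G_mono[OF borel_measurable_cond_exp]) auto
  from cond.real_cond_exp_diff[OF Y E, of n] cond.real_cond_exp_F_meas[OF E borel_measurable_cond_exp]
  show "AE x in M. real_cond_exp M (G n) (\<lambda>x. Y n x - ?E x) x = 0"
    by eventually_elim simp
qed

lemma cond_exp_square_diff_cond_exp_le: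
  assumes [measurable]: "Y \<in> borel_measurable M" and bound: "AE x in M. 0 \<le> Y x \<and> Y x \<le> c"
  shows "AE x in M. real_cond_exp M (G n) (\<lambda>x. (Y x - real_cond_exp M (G n) Y x)\<^sup>2) x
           \<le> 2 * c * real_cond_exp M (G n) Y x"
proof -
  let ?E = "real_cond_exp M (G n) Y"
  have Y: "integrable M Y" using bound by (intro integrable_const_bound[of _ c]) auto
  have E: "integrable M ?E" by (rule cond.real_cond_exp_int(1)[OF Y])
  have "AE x in M. 0 \<le> Y x" "AE x in M. Y x \<le> c" using bound by (auto elim: eventually_mono)
  from this cond.real_cond_exp_ge_c[OF Y this(1), of n] cond.real_cond_exp_le_c[OF Y this(2), of n]
  have square_le: "AE x in M. (Y x - ?E x)\<^sup>2 \<le> c * (Y x + ?E x)"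
  proof eventually_elim
    case (elim x)
    have "\<bar>Y x - ?E x\<bar> * \<bar>Y x - ?E x\<bar> \<le> c * (Y x + ?E x)"
      using elim by (intro mult_mono) auto
    thus ?case by (simp add: power2_eq_square)
  qed
  have "integrable M (\<lambda>x. (Y x - ?E x)\<^sup>2)"
  proof (rule Bochner_Integration.integrable_bound)
    show "integrable M (\<lambda>x. c * (Y x + ?E x))" using Y E by simp
    show "AE x in M. norm ((Y x - ?E x)\<^sup>2) \<le> norm (c * (Y x + ?E x))"
      using square_le by eventually_elim simp
  qed measurable
  hence "AE x in M. real_cond_exp M (G n) (\<lambda>x. (Y x - ?E x)\<^sup>2) x
      \<le> real_cond_exp M (G n) (\<lambda>x. c * (Y x + ?E x)) x"
    using square_le Y E by (intro cond.real_cond_exp_mono) auto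
  moreover have "AE x in M. real_cond_exp M (G n) (\<lambda>x. c * (Y x + ?E x)) x
      = c * real_cond_exp M (G n) (\<lambda>x. Y x + ?E x) x"
    using Y E by (intro cond.real_cond_exp_cmult) auto
  moreover note cond.real_cond_exp_add[OF Y E, of n]
    cond.real_cond_exp_F_meas[OF E borel_measurable_cond_exp]
  ultimately show ?thesis by eventually_elim (simp add: distrib_left)
qed

theorem levy_borel_cantelli:
  assumes adapted: "\<And>n. Y n \<in> borel_measurable (G (Suc n))"
    and bound: "\<And>n. AE x in M. 0 \<le> Y n x \<and> Y n x \<le> c"
  shows "AE x in M. filterlim (\<lambda>n. \<Sum>j<n. real_cond_exp M (G j) (Y j) x) at_top sequentially \<longrightarrow>
           filterlim (\<lambda>n. \<Sum>j<n. Y j x) at_top sequentially"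
proof -
  let ?E = "\<lambda>n. real_cond_exp M (G n) (Y n)"
  have [measurable]: "Y n \<in> borel_measurable M" for n using adapted measurable_G_imp_measurable by blast
  have "AE x in M. 0 \<le> c" using bound[of 0] by eventually_elim linarith
  hence "0 \<le> c" by simp
  have "integrable M (\<lambda>x. (Y n x)\<^sup>2)" for n
  proof (rule integrable_power2_if_AE_abs_le)
    show "AE x in M. \<bar>Y n x\<bar> \<le> c" using bound[of n] by eventually_elim simp
  qed measurable
  then interpret difference: square_integrable_martingale_differences M G "\<lambda>n x. Y n x - ?E n x"
    by (rule square_integrable_martingale_differences_diff_cond_exp[OF adapted])
  have "AE x in M. \<forall>n. 0 \<le> ?E n x"
    unfolding AE_all_countable
    using bound by (intro allI cond.real_cond_exp_pos) (auto elim: eventually_mono)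
  hence "AE x in M. filterlim (\<lambda>n. \<Sum>j<n. ?E j x) at_top sequentially \<longrightarrow>
      (\<lambda>n. (\<Sum>j<n. Y j x - ?E j x) / (\<Sum>j<n. ?E j x)) \<longlonglongrightarrow> 0"
    using \<open>0 \<le> c\<close> bound
    by (intro difference.AE_sum_div_weights_tendsto_0[where c = "2 * c"]
          cond_exp_square_diff_cond_exp_le) auto
  thus ?thesis
    by eventually_elim (auto simp: sum_subtractf intro: filterlim_at_top_if_relative_diff_tendsto_0)
qed

lemma cond_exp_square_weighted_diff_cond_exp_le:
  assumes [measurable]: "Z \<in> borel_measurable M" and Z_bound: "AE x in M. \<bar>Z x\<bar> \<le> r"
    and v: "v \<in> borel_measurable (G n)" and v_bound: "AE x in M. 0 \<le> v x \<and> v x \<le> c"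
  shows "AE x in M. real_cond_exp M (G n) (\<lambda>x. (v x * (Z x - real_cond_exp M (G n) Z x))\<^sup>2) x
           \<le> (2 * r)\<^sup>2 * c * v x"
proof -
  let ?E = "real_cond_exp M (G n) Z"
  have [measurable]: "v \<in> borel_measurable M" using measurable_G_imp_measurable[OF v] .
  have "AE x in M. \<bar>v x\<bar> \<le> c" using v_bound by eventually_elim simp
  hence dominating: "integrable M (\<lambda>x. (2 * r)\<^sup>2 * c * v x)"
    by (intro integrable_mult_right integrable_const_bound[of _ c]) auto
  have square_le: "AE x in M. (v x * (Z x - ?E x))\<^sup>2 \<le> (2 * r)\<^sup>2 * c * v x"
    using v_bound Z_bound cond.AE_abs_real_cond_exp_le[OF assms(1) Z_bound, of n]
  proof eventually_elim
    case (elim x)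
    hence "\<bar>Z x - ?E x\<bar> \<le> 2 * r" by linarith
    hence "(Z x - ?E x)\<^sup>2 \<le> (2 * r)\<^sup>2" by (metis abs_ge_zero power2_abs power_mono)
    moreover have "(v x)\<^sup>2 \<le> c * v x" using elim by (simp add: power2_eq_square mult_right_mono)
    ultimately have "(Z x - ?E x)\<^sup>2 * (v x)\<^sup>2 \<le> (2 * r)\<^sup>2 * (c * v x)"
      by (intro mult_mono) auto
    thus ?case by (simp add: power_mult_distrib mult_ac)
  qed
  have "integrable M (\<lambda>x. (v x * (Z x - ?E x))\<^sup>2)"
  proof (rule Bochner_Integration.integrable_bound[OF dominating])
    show "AE x in M. norm ((v x * (Z x - ?E x))\<^sup>2) \<le> norm ((2 * r)\<^sup>2 * c * v x)"
      using square_le by eventually_elim simp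
  qed measurable
  from cond.real_cond_exp_mono[OF square_le this dominating, of n]
    cond.real_cond_exp_F_meas[OF dominating borel_measurable_times[OF borel_measurable_const v]]
  show ?thesis by eventually_elim simp
qed

lemma AE_weighted_average_diff_cond_exp_tendsto_0:
  assumes Z_adapted: "\<And>n. Z n \<in> borel_measurable (G (Suc n))"
    and Z_bound: "\<And>n. AE x in M. \<bar>Z n x\<bar> \<le> r"
    and v_predictable: "\<And>n. v n \<in> borel_measurable (G n)"
    and v_bound: "\<And>n. AE x in M. 0 \<le> v n x \<and> v n x \<le> c"
  shows "AE x in M. filterlim (\<lambda>n. \<Sum>j<n. v j x) at_top sequentially \<longrightarrow>
    (\<lambda>n. (\<Sum>j<n. v j x * (Z j x - real_cond_exp M (G j) (Z j) x)) / (\<Sum>j<n. v j x)) \<longlonglongrightarrow> 0"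
proof -
  let ?E = "\<lambda>n. real_cond_exp M (G n) (Z n)"
  have [measurable]: "Z n \<in> borel_measurable M" for n
    using Z_adapted measurable_G_imp_measurable by blast
  have "integrable M (\<lambda>x. (Z n x)\<^sup>2)" for n
    by (rule integrable_power2_if_AE_abs_le[OF _ Z_bound]) measurable
  then interpret difference: square_integrable_martingale_differences M G "\<lambda>n x. Z n x - ?E n x"
    by (rule square_integrable_martingale_differences_diff_cond_exp[OF Z_adapted])
  have "AE x in M. \<bar>v n x\<bar> \<le> c" for n using v_bound[of n] by eventually_elim simp
  then interpret weighted: square_integrable_martingale_differences M G "\<lambda>n x. v n x * (Z n x - ?E n x)"
    by (rule difference.predictable_transform[OF v_predictable])
  have "AE x in M. 0 \<le> c" using v_bound[of 0] by eventually_elim linarith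
  hence "0 \<le> (2 * r)\<^sup>2 * c" by simp
  moreover have "AE x in M. \<forall>n. 0 \<le> v n x"
    unfolding AE_all_countable using v_bound by (auto elim: eventually_mono)
  moreover have "AE x in M. real_cond_exp M (G n) (\<lambda>x. (v n x * (Z n x - ?E n x))\<^sup>2) x
      \<le> (2 * r)\<^sup>2 * c * v n x" for n
    by (rule cond_exp_square_weighted_diff_cond_exp_le[OF _ Z_bound v_predictable v_bound]) measurable
  ultimately show ?thesis by (intro weighted.AE_sum_div_weights_tendsto_0[OF v_predictable])
qed

theorem AE_weighted_average_tendsto_cond_exp_limit:
  assumes Z_adapted: "\<And>n. Z n \<in> borel_measurable (G (Suc n))"
    and Z_bound: "\<And>n. AE x in M. \<bar>Z n x\<bar> \<le> r"
    and v_predictable: "\<And>n. v n \<in> borel_measurable (G n)"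
    and v_bound: "\<And>n. AE x in M. 0 \<le> v n x \<and> v n x \<le> c"
    and limit: "AE x in M. (\<lambda>n. real_cond_exp M (G n) (Z n) x) \<longlonglongrightarrow> L x"
  shows "AE x in M. filterlim (\<lambda>n. \<Sum>j<n. v j x) at_top sequentially \<longrightarrow>
           (\<lambda>n. (\<Sum>j<n. Z j x * v j x) / (\<Sum>j<n. v j x)) \<longlonglongrightarrow> L x"
proof -
  let ?E = "\<lambda>n. real_cond_exp M (G n) (Z n)"
  have "AE x in M. \<forall>n. 0 \<le> v n x"
    unfolding AE_all_countable using v_bound by (auto elim: eventually_mono)
  with AE_weighted_average_diff_cond_exp_tendsto_0[OF Z_adapted Z_bound v_predictable v_bound] limit
  show ?thesis
  proof eventually_elim
    case (elim x)
    show ?case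
    proof
      assume at_top: "filterlim (\<lambda>n. \<Sum>j<n. v j x) at_top sequentially"
      have "(\<lambda>n. (\<Sum>j<n. v j x * ?E j x) /\<^sub>R (\<Sum>j<n. v j x)) \<longlonglongrightarrow> L x"
        by (rule stolz_cesaro[OF _ at_top _ elim(2)]) (use elim(3) in \<open>auto intro: incseq_SucI\<close>)
      hence "(\<lambda>n. (\<Sum>j<n. v j x * (Z j x - ?E j x)) / (\<Sum>j<n. v j x)
                 + (\<Sum>j<n. v j x * ?E j x) / (\<Sum>j<n. v j x)) \<longlonglongrightarrow> 0 + L x"
        using elim(1) at_top by (intro tendsto_add) (auto simp: divide_inverse_commute)
      thus "(\<lambda>n. (\<Sum>j<n. Z j x * v j x) / (\<Sum>j<n. v j x)) \<longlonglongrightarrow> L x"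
        by (simp add: add_divide_distrib[symmetric] sum.distrib[symmetric]
            right_diff_distrib mult.commute)
    qed
  qed
qed

end

subsection \<open>Moments of the hypergeometric distribution\<close>

lemma choose_mult_add: "(n choose (i + l)) * ((i + l) choose i) = (n choose i) * ((n - i) choose l)"
  using choose_mult[of i "i + l" n]
  by (cases "i \<le> n"; cases "i + l \<le> n") (auto simp: not_le binomial_eq_0)

lemma sum_binomial_moment_vandermonde:
  "(\<Sum>k\<le>n. (k choose i) * ((n - k) choose j) * ((h choose k) * (g choose (n - k))))
      * ((h + g) choose (i + j))
    = (h choose i) * (g choose j) * (n choose (i + j)) * ((h + g) choose n)"
proof (cases "i + j \<le> n")
  case True
  then obtain m where n: "n = i + (j + m)" by (metis add.assoc le_Suc_ex)
  let ?t = "\<lambda>k. (k choose i) * ((n - k) choose j) * ((h choose k) * (g choose (n - k)))"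
  have shifted_term: "?t (i + l)
      = (h choose i) * (g choose j) * (((h - i) choose l) * ((g - j) choose (m - l)))"
    if "l \<le> m" for l
  proof -
    have "n - (i + l) = j + (m - l)" using n that by simp
    hence "?t (i + l)
        = ((h choose (i + l)) * ((i + l) choose i)) * ((g choose (j + (m - l))) * ((j + (m - l)) choose j))"
      by (simp only: mult_ac)
    thus ?thesis unfolding choose_mult_add by (simp only: mult_ac)
  qed
  have "(\<Sum>k\<le>n. ?t k) = (\<Sum>k\<in>{i..i + m}. ?t k)"
    by (intro sum.mono_neutral_right) (auto simp: n not_le)
  also have "\<dots> = (\<Sum>l\<le>m. ?t (i + l))"
    using sum.shift_bounds_cl_nat_ivl[of ?t 0 i m] by (simp add: atLeast0AtMost add.commute)
  also have "\<dots> = (\<Sum>l\<le>m. (h choose i) * (g choose j) * (((h - i) choose l) * ((g - j) choose (m - l))))"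
    using shifted_term by (intro sum.cong) auto
  also have "\<dots> = (h choose i) * (g choose j) * (((h - i) + (g - j)) choose m)"
    by (simp only: sum_distrib_left[symmetric] vandermonde)
  finally have "(\<Sum>k\<le>n. ?t k) = (h choose i) * (g choose j) * (((h - i) + (g - j)) choose m)" .
  moreover have "((h + g) choose (i + j)) * ((h + g - (i + j)) choose m)
      = (n choose (i + j)) * ((h + g) choose n)"
    unfolding n add.assoc[symmetric] choose_mult_add[symmetric] by (rule mult.commute)
  ultimately show ?thesis
    by (cases "i \<le> h \<and> j \<le> g") (auto simp: mult_ac not_le)
next
  case False
  hence "(k choose i) * ((n - k) choose j) = 0" if "k \<le> n" for k using that by auto
  hence sum_eq_0: "(\<Sum>k\<le>n. (k choose i) * ((n - k) choose j) * ((h choose k) * (g choose (n - k)))) = 0"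
    by (intro sum.neutral) auto
  show ?thesis unfolding sum_eq_0 using False by simp
qed

lemma set_hypergeometric_pmf: "n \<le> s \<Longrightarrow> h \<le> s \<Longrightarrow> set_pmf (hypergeometric_pmf n s h) \<subseteq> {..n}"
  by (auto simp: set_pmf_iff pmf_hypergeometric split: if_splits)

abbreviation hypergeometric_expectation :: "nat \<Rightarrow> nat \<Rightarrow> nat \<Rightarrow> (nat \<Rightarrow> real) \<Rightarrow> real" where
  "hypergeometric_expectation n s h \<equiv> measure_pmf.expectation (hypergeometric_pmf n s h)"

lemma hypergeometric_expectation_eq_sum:
  fixes f :: "nat \<Rightarrow> real"
  assumes "n \<le> s" "h \<le> s"
  shows "hypergeometric_expectation n s h f
    = (\<Sum>k\<le>n. f k * (real (h choose k) * real ((s - h) choose (n - k)))) / real (s choose n)"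
proof -
  have "hypergeometric_expectation n s h f = (\<Sum>k\<le>n. f k * pmf (hypergeometric_pmf n s h) k)"
    using set_hypergeometric_pmf[OF assms] by (intro integral_measure_pmf_real) auto
  also have "\<dots> = (\<Sum>k\<le>n. f k * (real (h choose k) * real ((s - h) choose (n - k)))) / real (s choose n)"
    unfolding sum_divide_distrib using assms by (intro sum.cong) (auto simp: pmf_hypergeometric)
  finally show ?thesis .
qed

lemma hypergeometric_binomial_moment:
  assumes "n \<le> s" "h \<le> s" "i + j \<le> s"
  shows "hypergeometric_expectation n s h (\<lambda>k. real (k choose i) * real ((n - k) choose j))
    = real (h choose i) * real ((s - h) choose j) * real (n choose (i + j)) / real (s choose (i + j))"
proof -
  let ?moment = "\<Sum>k\<le>n. (k choose i) * ((n - k) choose j) * ((h choose k) * ((s - h) choose (n - k)))"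
  have "?moment * (s choose (i + j))
      = (h choose i) * ((s - h) choose j) * (n choose (i + j)) * (s choose n)"
    using sum_binomial_moment_vandermonde[of i n j h "s - h"] \<open>h \<le> s\<close> by simp
  hence "real ?moment * real (s choose (i + j))
      = real (h choose i) * real ((s - h) choose j) * real (n choose (i + j)) * real (s choose n)"
    by (simp only: of_nat_mult[symmetric])
  moreover have "real (s choose n) \<noteq> 0" "real (s choose (i + j)) \<noteq> 0" using assms by auto
  ultimately have "real ?moment / real (s choose n)
      = real (h choose i) * real ((s - h) choose j) * real (n choose (i + j)) / real (s choose (i + j))"
    by (simp add: frac_eq_eq)
  thus ?thesis using assms by (simp add: hypergeometric_expectation_eq_sum)
qed

lemma hypergeometric_expectation_cong:
  assumes "n \<le> s" "h \<le> s" "\<And>k. k \<le> n \<Longrightarrow> f k = (g k :: real)"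
  shows "hypergeometric_expectation n s h f = hypergeometric_expectation n s h g"
  using assms by (simp add: hypergeometric_expectation_eq_sum)

lemma hypergeometric_expectation_drawn:
  assumes "n \<le> s" "h \<le> s" "1 \<le> s"
  shows "hypergeometric_expectation n s h real = real n * real h / real s"
  using hypergeometric_binomial_moment[of n s h 1 0] assms by (simp add: mult.commute)

lemma hypergeometric_expectation_not_drawn:
  assumes "n \<le> s" "h \<le> s" "1 \<le> s"
  shows "hypergeometric_expectation n s h (\<lambda>k. real n - real k)
    = real n * (real s - real h) / real s"
proof -
  have "hypergeometric_expectation n s h (\<lambda>k. real n - real k)
      = hypergeometric_expectation n s h (\<lambda>k. real (k choose 0) * real ((n - k) choose 1))"
    using assms by (intro hypergeometric_expectation_cong) auto
  also have "\<dots> = real n * (real s - real h) / real s"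
    using assms by (subst hypergeometric_binomial_moment) (auto simp: mult.commute of_nat_diff)
  finally show ?thesis .
qed

lemma hypergeometric_expectation_product:
  assumes "n \<le> s" "h \<le> s" "2 \<le> s"
  shows "hypergeometric_expectation n s h (\<lambda>k. real k * (real n - real k))
    = real h * (real s - real h) * (real n * (real n - 1)) / (real s * (real s - 1))"
proof -
  have choose_2: "real (m choose 2) = real m * (real m - 1) / 2" for m
    by (simp add: binomial_gbinomial gbinomial_pochhammer' pochhammer_rec' numeral_2_eq_2)
  have "hypergeometric_expectation n s h (\<lambda>k. real k * (real n - real k))
      = hypergeometric_expectation n s h (\<lambda>k. real (k choose 1) * real ((n - k) choose 1))"
    using assms by (intro hypergeometric_expectation_cong) auto
  also have "\<dots> = real h * (real s - real h) * real (n choose 2) / real (s choose 2)"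
    using assms by (subst hypergeometric_binomial_moment) (auto simp: of_nat_diff numeral_2_eq_2)
  finally show ?thesis by (simp add: choose_2)
qed

lemma hypergeometric_expectation_product_ge:
  assumes "1 \<le> n" "n \<le> s" "1 \<le> h" "h < s"
  shows "(real n - 1) / real s \<le> hypergeometric_expectation n s h (\<lambda>k. real k * (real n - real k))"
proof -
  have "real h + 1 \<le> real s" using assms by simp
  hence "0 \<le> (real h - 1) * (real s - real h - 1)" using assms by (intro mult_nonneg_nonneg) auto
  hence "real s - 1 \<le> real h * (real s - real h)" by (simp add: algebra_simps)
  hence "(real s - 1) * (1 * (real n - 1)) \<le> real h * (real s - real h) * (real n * (real n - 1))"
    using assms by (intro mult_mono) auto
  hence "(real s - 1) * (1 * (real n - 1)) / (real s * (real s - 1))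
      \<le> real h * (real s - real h) * (real n * (real n - 1)) / (real s * (real s - 1))"
    using assms by (intro divide_right_mono) auto
  thus ?thesis using assms by (simp add: hypergeometric_expectation_product)
qed

subsection \<open>Generated sigma-algebras and independence\<close>

lemma space_gen_sigma: "space (gen_sigma M \<Y>) = space M"
  by (simp add: gen_sigma_def space_measure_of_conv)

lemma sets_gen_sigma:
  "sets (gen_sigma M \<Y>) = sigma_sets (space M) {Y -` S \<inter> space M | Y S. Y \<in> \<Y>}"
  unfolding gen_sigma_def by (rule sets_measure_of) auto

lemma sets_gen_sigma_mono: "\<Y> \<subseteq> \<Z> \<Longrightarrow> sets (gen_sigma M \<Y>) \<subseteq> sets (gen_sigma M \<Z>)"
  unfolding sets_gen_sigma by (rule sigma_sets_mono') auto

lemma measurable_gen_sigma: "Y \<in> \<Y> \<Longrightarrow> Y \<in> measurable (gen_sigma M \<Y>) (count_space UNIV)"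
  by (rule measurableI) (auto simp: sets_gen_sigma space_gen_sigma intro!: sigma_sets.Basic)

lemma measurable_gen_sigma_mono:
  assumes "\<Y> \<subseteq> \<Z>" "f \<in> measurable (gen_sigma M \<Y>) L"
  shows "f \<in> measurable (gen_sigma M \<Z>) L"
  using assms sets_gen_sigma_mono[OF assms(1), of M] by (auto simp: measurable_def space_gen_sigma)

lemma measurable_compose_countable2:
  fixes f :: "'i::countable \<Rightarrow> 'j::countable \<Rightarrow> 'b"
  assumes "g \<in> measurable M (count_space UNIV)" "h \<in> measurable M (count_space UNIV)"
    and "\<And>i j. f i j \<in> space L"
  shows "(\<lambda>x. f (g x) (h x)) \<in> measurable M L"
  by (rule measurable_compose_countable[OF measurable_compose_countable[OF _ assms(2)] assms(1)])
     (use assms(3) in simp)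

lemma (in prob_space) filtered_prob_space_gen_sigma:
  assumes measurable: "\<And>n Y. Y \<in> \<Y> n \<Longrightarrow> Y \<in> measurable M (count_space UNIV)"
    and mono: "\<And>n. \<Y> n \<subseteq> \<Y> (Suc n)"
  shows "filtered_prob_space M (\<lambda>n. gen_sigma M (\<Y> n))"
proof
  show "sets (gen_sigma M (\<Y> n)) \<subseteq> sets M" for n
    unfolding sets_gen_sigma using measurable
    by (intro sets.sigma_sets_subset) (auto dest: measurable_sets)
  show "sets (gen_sigma M (\<Y> m)) \<subseteq> sets (gen_sigma M (\<Y> n))" if "m \<le> n" for m n
    using lift_Suc_mono_le[of \<Y>, OF mono that] by (rule sets_gen_sigma_mono)
qed (rule space_gen_sigma)

lemma (in prob_space) real_cond_exp_indep:
  assumes indep: "indep_set (sets P) (sets Q)"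
    and subalgebras: "subalgebra M P" "subalgebra M Q"
    and f: "f \<in> borel_measurable P" "integrable M f"
  shows "AE x in M. real_cond_exp M Q f x = expectation f"
proof -
  interpret Q: finite_measure_subalgebra M Q by unfold_locales (rule subalgebras(2))
  have generated: "sigma_sets (space M) {g -` S \<inter> space M |S. S \<in> sets borel} \<subseteq> sets R"
    if "g \<in> borel_measurable R" "subalgebra M R" for g :: "'a \<Rightarrow> real" and R
  proof -
    have space_R: "space M = space R" using that(2) by (simp add: subalgebra_def)
    show ?thesis
      unfolding space_R using measurable_sets[OF that(1)] by (intro sets.sigma_sets_subset) auto
  qed
  show ?thesis
  proof (rule Q.real_cond_exp_charact[OF _ f(2)])
    fix E assume E: "E \<in> sets Q"
    hence E_event: "E \<in> events" using subalgebras(2) by (auto simp: subalgebra_def)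
    have "indep_var borel f borel (indicator E :: 'a \<Rightarrow> real)"
      unfolding indep_var_eq
    proof (intro conjI)
      show "indep_set (sigma_sets (space M) {f -` S \<inter> space M |S. S \<in> sets borel})
          (sigma_sets (space M) {indicator E -` S \<inter> space M |S. S \<in> sets (borel :: real measure)})"
        using indep generated[OF f(1) subalgebras(1)]
          generated[OF borel_measurable_indicator[OF E] subalgebras(2)]
        unfolding indep_set_def by (elim indep_sets_mono_sets) (auto split: bool.split)
    qed (use f(2) E_event in auto)
    hence "(\<integral>x. f x * indicator E x \<partial>M) = expectation f * (\<integral>x. indicator E x \<partial>M)"
      using f(2) E_event by (intro indep_var_lebesgue_integral) (auto simp: less_top[symmetric])
    thus "(\<integral>x\<in>E. f x \<partial>M) = (\<integral>x\<in>E. expectation f \<partial>M)"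
      using E_event by (simp add: set_lebesgue_integral_def mult.commute)
  qed auto
qed

lemma (in finite_measure_subalgebra) measure_eq_integral_cond_exp:
  assumes "E \<in> sets M"
  shows "measure M E = (\<integral>x. real_cond_exp M F (indicator E) x \<partial>M)"
  using assms by (subst real_cond_exp_int(2)) (auto simp: less_top[symmetric] emeasure_eq_measure)

lemma finite_box_bounded:
  fixes f :: "nat \<Rightarrow> nat \<Rightarrow> real"
  obtains r where "\<And>i j. i \<le> c \<Longrightarrow> j \<le> c \<Longrightarrow> \<bar>f i j\<bar> \<le> r"
proof
  show "\<bar>f i j\<bar> \<le> (\<Sum>i\<le>c. \<Sum>j\<le>c. \<bar>f i j\<bar>)" if "i \<le> c" "j \<le> c" for i j
  proof -
    have "\<bar>f i j\<bar> \<le> (\<Sum>j\<le>c. \<bar>f i j\<bar>)" using that by (intro member_le_sum) auto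
    also have "\<dots> \<le> (\<Sum>i\<le>c. \<Sum>j\<le>c. \<bar>f i j\<bar>)"
      using that by (intro member_le_sum[of i _ "\<lambda>i. \<Sum>j\<le>c. \<bar>f i j\<bar>"]) (auto intro: sum_nonneg)
    finally show ?thesis .
  qed
qed

subsection \<open>The urn\<close>

context urn_model
begin

abbreviation F :: "nat \<Rightarrow> 'w measure" where "F \<equiv> urn_F M N X A B"
abbreviation FN :: "nat \<Rightarrow> 'w measure" where
  "FN \<equiv> \<lambda>n. gen_sigma M (urn_vars N X A B n \<union> {N (Suc n)})"
abbreviation FX :: "nat \<Rightarrow> 'w measure" where
  "FX \<equiv> \<lambda>n. gen_sigma M (urn_vars N X A B n \<union> {N (Suc n), X (Suc n)})"
abbreviation H :: "nat \<Rightarrow> 'w \<Rightarrow> nat" where "H \<equiv> urn_H a X A"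
abbreviation S :: "nat \<Rightarrow> 'w \<Rightarrow> nat" where "S \<equiv> \<lambda>n \<omega>. H n \<omega> + urn_K b N X B n \<omega>"

lemma urn_vars_Suc:
  "urn_vars N X A B (Suc n) = urn_vars N X A B n \<union> {N (Suc n), X (Suc n), A (Suc n), B (Suc n)}"
  by (auto simp: urn_vars_def atLeastAtMostSuc_conv)

lemma urn_vars_measurable: "Y \<in> urn_vars N X A B n \<Longrightarrow> Y \<in> measurable M (count_space UNIV)"
  using rv by (auto simp: urn_vars_def)

sublocale F: filtered_prob_space M F
  unfolding urn_F_def[abs_def]
  by (rule filtered_prob_space_gen_sigma) (auto simp: urn_vars_Suc intro: urn_vars_measurable)

sublocale FN: filtered_prob_space M FN
  by (rule filtered_prob_space_gen_sigma) (auto simp: urn_vars_Suc intro: urn_vars_measurable rv)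

sublocale FX: filtered_prob_space M FX
  by (rule filtered_prob_space_gen_sigma) (auto simp: urn_vars_Suc intro: urn_vars_measurable rv)

lemma measurable_F_imp_FN: "f \<in> measurable (F n) L \<Longrightarrow> f \<in> measurable (FN n) L"
  unfolding urn_F_def by (rule measurable_gen_sigma_mono[rotated]) auto

lemma measurable_F_imp_FX: "f \<in> measurable (F n) L \<Longrightarrow> f \<in> measurable (FX n) L"
  unfolding urn_F_def by (rule measurable_gen_sigma_mono[rotated]) auto

lemma measurable_F:
  assumes "1 \<le> j" "j \<le> n"
  shows "N j \<in> measurable (F n) (count_space UNIV)" "X j \<in> measurable (F n) (count_space UNIV)"
    "A j \<in> measurable (F n) (count_space UNIV)" "B j \<in> measurable (F n) (count_space UNIV)"
  using assms by (auto simp: urn_F_def urn_vars_def intro!: measurable_gen_sigma)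

lemma measurable_H_F: "H n \<in> measurable (F n) (count_space UNIV)"
proof -
  have "(\<lambda>\<omega>. \<Sum>j=1..n. A j \<omega> * X j \<omega>) \<in> measurable (F n) (count_space UNIV)"
    by (intro measurable_sum_nat measurable_compose_countable2[where f = "(*)"] measurable_F) auto
  thus ?thesis unfolding urn_H_def by measurable
qed

lemma measurable_S_F: "S n \<in> measurable (F n) (count_space UNIV)"
proof -
  have "(\<lambda>\<omega>. \<Sum>j=1..n. B j \<omega> * (N j \<omega> - X j \<omega>)) \<in> measurable (F n) (count_space UNIV)"
    by (intro measurable_sum_nat measurable_compose_countable2[where f = "(*)"]
          measurable_compose_countable2[where f = "(-)"] measurable_F) auto
  hence "urn_K b N X B n \<in> measurable (F n) (count_space UNIV)" unfolding urn_K_def by measurable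
  thus ?thesis by (intro measurable_compose_countable2[where f = "(+)"] measurable_H_F) auto
qed

lemma borel_measurable_FN:
  fixes f :: "nat \<Rightarrow> nat \<Rightarrow> nat \<Rightarrow> real"
  shows "(\<lambda>\<omega>. f (N (Suc n) \<omega>) (S n \<omega>) (H n \<omega>)) \<in> borel_measurable (FN n)"
  by (rule measurable_compose_countable[OF measurable_compose_countable2
        [OF measurable_F_imp_FN[OF measurable_S_F] measurable_F_imp_FN[OF measurable_H_F]]])
     (auto intro: measurable_gen_sigma)

lemma borel_measurable_FX:
  fixes f :: "nat \<Rightarrow> nat \<Rightarrow> real"
  shows "(\<lambda>\<omega>. f (N (Suc n) \<omega>) (X (Suc n) \<omega>)) \<in> borel_measurable (FX n)"
  by (rule measurable_compose_countable2) (auto intro: measurable_gen_sigma)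

lemma borel_measurable_F_Suc:
  fixes f :: "nat \<Rightarrow> nat \<Rightarrow> real"
  shows "(\<lambda>\<omega>. f (N (Suc n) \<omega>) (X (Suc n) \<omega>)) \<in> borel_measurable (F (Suc n))"
    "(\<lambda>\<omega>. f (A (Suc n) \<omega>) (B (Suc n) \<omega>)) \<in> borel_measurable (F (Suc n))"
  by (rule measurable_compose_countable2; auto intro: measurable_F)+

definition C :: nat where
  "C = (SOME C. \<forall>n\<ge>1. AE \<omega> in M. A n \<omega> \<le> C \<and> B n \<omega> \<le> C \<and> N n \<omega> \<le> C)"

lemma AE_le_C: "AE \<omega> in M. \<forall>n\<ge>1. A n \<omega> \<le> C \<and> B n \<omega> \<le> C \<and> N n \<omega> \<le> C"
proof -
  have "\<forall>n\<ge>1. AE \<omega> in M. A n \<omega> \<le> C \<and> B n \<omega> \<le> C \<and> N n \<omega> \<le> C"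
    unfolding C_def by (rule someI_ex[OF bounded])
  thus ?thesis by (auto simp: AE_all_countable)
qed

lemma AE_N_le_S: "AE \<omega> in M. \<forall>n. 1 \<le> N (Suc n) \<omega> \<and> N (Suc n) \<omega> \<le> S n \<omega>"
  unfolding AE_all_countable
proof
  fix n
  define E where "E = {\<omega> \<in> space M. N (Suc n) \<omega> \<in> {1..S n \<omega>}}"
  have "Measurable.pred M (\<lambda>\<omega>. N (Suc n) \<omega> \<in> {1..S n \<omega>})"
    using rv F.measurable_G_imp_measurable[OF measurable_S_F]
    by (intro measurable_compose_countable2[where f = "\<lambda>i s. i \<in> {1..s}"]) auto
  hence "E \<in> events" by (simp add: E_def pred_def)
  hence "prob E = (\<integral>\<omega>. real_cond_exp M (F n) (indicator E) \<omega> \<partial>M)"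
    by (rule F.cond.measure_eq_integral_cond_exp)
  also have "\<dots> = (\<integral>\<omega>. 1 \<partial>M)"
    using N_concentrated[of n] by (intro integral_cong_AE) (auto simp: E_def)
  finally have "prob E = 1" by (simp add: prob_space)
  thus "AE \<omega> in M. 1 \<le> N (Suc n) \<omega> \<and> N (Suc n) \<omega> \<le> S n \<omega>"
    using AE_prob_1[of E] by (simp add: E_def)
qed

lemma H_ge_1: "1 \<le> H n \<omega>" and H_less_S: "H n \<omega> < S n \<omega>"
  using init by (auto simp: urn_H_def urn_K_def)

abbreviation draw_pmf :: "nat \<Rightarrow> 'w \<Rightarrow> nat pmf" where
  "draw_pmf \<equiv> \<lambda>n \<omega>. hypergeometric_pmf (N (Suc n) \<omega>) (S n \<omega>) (H n \<omega>)"

abbreviation mean_draw :: "(nat \<Rightarrow> nat \<Rightarrow> real) \<Rightarrow> nat \<Rightarrow> 'w \<Rightarrow> real" where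
  "mean_draw \<equiv> \<lambda>\<phi> n \<omega>. measure_pmf.expectation (draw_pmf n \<omega>) (\<phi> (N (Suc n) \<omega>))"

lemma
  assumes g: "g \<in> borel_measurable (FN n)" and bound: "AE \<omega> in M. \<bar>g \<omega>\<bar> \<le> r"
  shows integrable_mult_indicator_draw:
      "integrable M (\<lambda>\<omega>. g \<omega> * indicator {\<omega> \<in> space M. X (Suc n) \<omega> = k} \<omega>)"
      (is "integrable M (\<lambda>\<omega>. g \<omega> * ?I \<omega>)")
    and cond_exp_mult_indicator_draw:
      "AE \<omega> in M. real_cond_exp M (FN n) (\<lambda>\<omega>. g \<omega> * indicator {\<omega> \<in> space M. X (Suc n) \<omega> = k} \<omega>) \<omega>
        = g \<omega> * pmf (draw_pmf n \<omega>) k"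
proof -
  have [measurable]: "g \<in> borel_measurable M" "X (Suc n) \<in> measurable M (count_space UNIV)"
    using FN.measurable_G_imp_measurable[OF g] rv by auto
  show integrable: "integrable M (\<lambda>\<omega>. g \<omega> * ?I \<omega>)"
  proof (rule integrable_const_bound)
    show "AE \<omega> in M. norm (g \<omega> * ?I \<omega>) \<le> r" using bound by eventually_elim (auto simp: indicator_def)
  qed measurable
  have "AE \<omega> in M. real_cond_exp M (FN n) (\<lambda>\<omega>. g \<omega> * ?I \<omega>) \<omega> = g \<omega> * real_cond_exp M (FN n) ?I \<omega>"
    using g integrable by (intro FN.cond.real_cond_exp_mult) auto
  thus "AE \<omega> in M. real_cond_exp M (FN n) (\<lambda>\<omega>. g \<omega> * ?I \<omega>) \<omega> = g \<omega> * pmf (draw_pmf n \<omega>) k"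
    using X_hypergeometric[of n k] by eventually_elim simp
qed

lemma AE_X_le_N: "AE \<omega> in M. \<forall>n. X (Suc n) \<omega> \<le> N (Suc n) \<omega>"
  unfolding AE_all_countable
proof
  fix n
  have [measurable]: "N (Suc n) \<in> measurable M (count_space UNIV)"
    "X (Suc n) \<in> measurable M (count_space UNIV)"
    using rv by auto
  have "AE \<omega> in M. \<not> (X (Suc n) \<omega> = k \<and> N (Suc n) \<omega> < k)" for k
  proof -
    define E where "E = {\<omega> \<in> space M. X (Suc n) \<omega> = k \<and> N (Suc n) \<omega> < k}"
    let ?g = "\<lambda>\<omega>. if N (Suc n) \<omega> < k then 1 else 0 :: real"
    let ?I = "indicator {\<omega> \<in> space M. X (Suc n) \<omega> = k} :: 'w \<Rightarrow> real"
    have E [measurable]: "E \<in> events" unfolding E_def by measurable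
    have g: "?g \<in> borel_measurable (FN n)"
      by (rule borel_measurable_FN[of "\<lambda>i s h. if i < k then 1 else 0"])
    have "AE \<omega> in M. real_cond_exp M (FN n) (indicator E) \<omega> = real_cond_exp M (FN n) (\<lambda>\<omega>. ?g \<omega> * ?I \<omega>) \<omega>"
      by (intro FN.cond.real_cond_exp_cong AE_I2) (auto simp: E_def indicator_def)
    moreover have "AE \<omega> in M. \<bar>?g \<omega>\<bar> \<le> 1" by simp
    note cond_exp_mult_indicator_draw[OF g this, of k]
    ultimately have "AE \<omega> in M. real_cond_exp M (FN n) (indicator E) \<omega> = 0"
      using AE_N_le_S
    proof eventually_elim
      case (elim \<omega>)
      show ?case
        unfolding elim(1,2) using elim(3) H_less_S[of n \<omega>] by (auto simp: pmf_hypergeometric)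
    qed
    hence "(\<integral>\<omega>. real_cond_exp M (FN n) (indicator E) \<omega> \<partial>M) = (\<integral>\<omega>. 0 \<partial>M)"
      by (intro integral_cong_AE) auto
    hence "prob E = 0" using FN.cond.measure_eq_integral_cond_exp[OF E, of n] by simp
    hence "AE \<omega> in M. \<omega> \<notin> E" using E by (simp add: prob_eq_0)
    thus ?thesis using AE_space by eventually_elim (simp add: E_def)
  qed
  hence "AE \<omega> in M. \<forall>k. \<not> (X (Suc n) \<omega> = k \<and> N (Suc n) \<omega> < k)" by (simp only: AE_all_countable) simp
  thus "AE \<omega> in M. X (Suc n) \<omega> \<le> N (Suc n) \<omega>" by eventually_elim auto
qed

lemma AE_X_le_C: "AE \<omega> in M. \<forall>n. X (Suc n) \<omega> \<le> C"
  using AE_le_C AE_X_le_N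
proof eventually_elim
  case (elim \<omega>)
  show ?case
  proof
    fix n
    have "X (Suc n) \<omega> \<le> N (Suc n) \<omega>" "N (Suc n) \<omega> \<le> C" using elim by auto
    thus "X (Suc n) \<omega> \<le> C" by linarith
  qed
qed

lemma AE_S_le: "AE \<omega> in M. \<forall>n. S n \<omega> \<le> (a + b + C * C) * Suc n"
  using AE_le_C AE_X_le_N
proof eventually_elim
  case (elim \<omega>)
  show ?case
  proof
    fix n
    show "S n \<omega> \<le> (a + b + C * C) * Suc n"
    proof (induction n)
      case 0
      show ?case by (simp add: urn_H_def urn_K_def)
    next
      case (Suc n)
      let ?X = "X (Suc n) \<omega>" and ?N = "N (Suc n) \<omega>"
      have le: "A (Suc n) \<omega> \<le> C" "B (Suc n) \<omega> \<le> C" "?N \<le> C" "?X \<le> ?N" using elim by auto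
      have "A (Suc n) \<omega> * ?X + B (Suc n) \<omega> * (?N - ?X) \<le> C * ?X + C * (?N - ?X)"
        using le by (intro add_mono mult_right_mono) auto
      also have "\<dots> = C * ?N" using le by (simp add: distrib_left[symmetric])
      also have "\<dots> \<le> C * C" using le by simp
      finally show ?case using Suc by (simp add: urn_H_def urn_K_def)
    qed
  qed
qed

lemma AE_bounded_draw:
  fixes \<phi> :: "nat \<Rightarrow> nat \<Rightarrow> real"
  obtains r where "\<And>n. AE \<omega> in M. \<bar>\<phi> (N (Suc n) \<omega>) (X (Suc n) \<omega>)\<bar> \<le> r"
proof -
  obtain r where r: "\<And>i j. i \<le> C \<Longrightarrow> j \<le> C \<Longrightarrow> \<bar>\<phi> i j\<bar> \<le> r"
    using finite_box_bounded by blast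
  have "AE \<omega> in M. \<bar>\<phi> (N (Suc n) \<omega>) (X (Suc n) \<omega>)\<bar> \<le> r" for n
    using AE_le_C AE_X_le_C by eventually_elim (auto intro: r)
  thus ?thesis by (rule that)
qed

lemma AE_draw_eq_sum_indicator:
  fixes \<phi> :: "nat \<Rightarrow> nat \<Rightarrow> real"
  shows "AE \<omega> in M. \<phi> (N (Suc n) \<omega>) (X (Suc n) \<omega>)
    = (\<Sum>k\<le>C. \<phi> (N (Suc n) \<omega>) k * indicator {\<omega> \<in> space M. X (Suc n) \<omega> = k} \<omega>)"
  using AE_X_le_C AE_space
proof eventually_elim
  case (elim \<omega>)
  have "(\<Sum>k\<le>C. \<phi> (N (Suc n) \<omega>) k * indicator {\<omega> \<in> space M. X (Suc n) \<omega> = k} \<omega>)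
      = (\<Sum>k\<le>C. if k = X (Suc n) \<omega> then \<phi> (N (Suc n) \<omega>) k else 0)"
    using elim(2) by (intro sum.cong) auto
  thus ?case using elim(1) by simp
qed

lemma cond_exp_draw:
  fixes \<phi> :: "nat \<Rightarrow> nat \<Rightarrow> real"
  shows "AE \<omega> in M. real_cond_exp M (FN n) (\<lambda>\<omega>. \<phi> (N (Suc n) \<omega>) (X (Suc n) \<omega>)) \<omega> = mean_draw \<phi> n \<omega>"
proof -
  let ?N = "N (Suc n)" and ?X = "X (Suc n)"
  let ?I = "\<lambda>k. indicator {\<omega> \<in> space M. ?X \<omega> = k} :: 'w \<Rightarrow> real"
  have \<phi>_N: "(\<lambda>\<omega>. \<phi> (?N \<omega>) k) \<in> borel_measurable (FN n)" for k
    by (rule borel_measurable_FN[of "\<lambda>i s h. \<phi> i k"])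
  have [measurable]: "(\<lambda>\<omega>. \<phi> (?N \<omega>) (?X \<omega>)) \<in> borel_measurable M"
    by (rule FX.measurable_G_imp_measurable[OF borel_measurable_FX])
  have bounded_\<phi>_N: "\<exists>r. AE \<omega> in M. \<bar>\<phi> (?N \<omega>) k\<bar> \<le> r" for k
    using AE_bounded_draw[of "\<lambda>i j. \<phi> i k"] by metis
  have integrable: "integrable M (\<lambda>\<omega>. \<phi> (?N \<omega>) k * ?I k \<omega>)" for k
    using bounded_\<phi>_N integrable_mult_indicator_draw[OF \<phi>_N] by blast
  have "AE \<omega> in M. real_cond_exp M (FN n) (\<lambda>\<omega>. \<phi> (?N \<omega>) (?X \<omega>)) \<omega>
      = real_cond_exp M (FN n) (\<lambda>\<omega>. \<Sum>k\<le>C. \<phi> (?N \<omega>) k * ?I k \<omega>) \<omega>"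
    using AE_draw_eq_sum_indicator
    by (intro FN.cond.real_cond_exp_cong borel_measurable_sum
          borel_measurable_integrable[OF integrable]) auto
  moreover have "AE \<omega> in M. real_cond_exp M (FN n) (\<lambda>\<omega>. \<Sum>k\<le>C. \<phi> (?N \<omega>) k * ?I k \<omega>) \<omega>
      = (\<Sum>k\<le>C. real_cond_exp M (FN n) (\<lambda>\<omega>. \<phi> (?N \<omega>) k * ?I k \<omega>) \<omega>)"
    by (rule FN.cond.real_cond_exp_sum[OF integrable])
  moreover have "AE \<omega> in M. \<forall>k. real_cond_exp M (FN n) (\<lambda>\<omega>. \<phi> (?N \<omega>) k * ?I k \<omega>) \<omega>
      = \<phi> (?N \<omega>) k * pmf (draw_pmf n \<omega>) k"
    unfolding AE_all_countable using bounded_\<phi>_N cond_exp_mult_indicator_draw[OF \<phi>_N] by blast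
  ultimately show ?thesis
    using AE_N_le_S AE_le_C
  proof eventually_elim
    case (elim \<omega>)
    have "?N \<omega> \<le> S n \<omega>" "?N \<omega> \<le> C" using elim(4,5) by auto
    hence "set_pmf (draw_pmf n \<omega>) \<subseteq> {..C}"
      using set_hypergeometric_pmf[of "?N \<omega>" "S n \<omega>" "H n \<omega>"] H_less_S[of n \<omega>] by auto
    hence "mean_draw \<phi> n \<omega> = (\<Sum>k\<le>C. \<phi> (?N \<omega>) k * pmf (draw_pmf n \<omega>) k)"
      by (intro integral_measure_pmf_real) auto
    thus ?case unfolding elim(1,2) by (simp only: elim(3))
  qed
qed

lemma AE_sum_draws_at_top:
  fixes \<phi> :: "nat \<Rightarrow> nat \<Rightarrow> real"
  assumes nonneg: "\<And>m k. k \<le> m \<Longrightarrow> 0 \<le> \<phi> m k"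
  shows "AE \<omega> in M. \<not> summable (\<lambda>n. mean_draw \<phi> n \<omega>) \<longrightarrow>
    filterlim (\<lambda>n. \<Sum>j<n. \<phi> (N (Suc j) \<omega>) (X (Suc j) \<omega>)) at_top sequentially"
proof -
  let ?Y = "\<lambda>n \<omega>. \<phi> (N (Suc n) \<omega>) (X (Suc n) \<omega>)"
  obtain r where r: "\<And>n. AE \<omega> in M. \<bar>?Y n \<omega>\<bar> \<le> r" using AE_bounded_draw[of \<phi>] by blast
  have "AE \<omega> in M. filterlim (\<lambda>n. \<Sum>j<n. real_cond_exp M (FN j) (?Y j) \<omega>) at_top sequentially \<longrightarrow>
      filterlim (\<lambda>n. \<Sum>j<n. ?Y j \<omega>) at_top sequentially"
  proof (rule FN.levy_borel_cantelli)
    show "?Y n \<in> borel_measurable (FN (Suc n))" for n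
      by (rule measurable_F_imp_FN[OF borel_measurable_F_Suc(1)])
    show "AE \<omega> in M. 0 \<le> ?Y n \<omega> \<and> ?Y n \<omega> \<le> r" for n
      using r[of n] AE_X_le_N by eventually_elim (auto intro: nonneg)
  qed
  moreover have "AE \<omega> in M. \<forall>n. real_cond_exp M (FN n) (?Y n) \<omega> = mean_draw \<phi> n \<omega>"
    unfolding AE_all_countable using cond_exp_draw by blast
  ultimately show ?thesis
    using AE_N_le_S
  proof eventually_elim
    case (elim \<omega>)
    have "0 \<le> mean_draw \<phi> n \<omega>" for n
    proof (rule integral_nonneg_AE, unfold AE_measure_pmf_iff, rule ballI)
      fix k assume "k \<in> set_pmf (draw_pmf n \<omega>)"
      thus "0 \<le> \<phi> (N (Suc n) \<omega>) k"
        using elim(3) H_less_S[of n \<omega>] set_hypergeometric_pmf[of "N (Suc n) \<omega>" "S n \<omega>" "H n \<omega>"]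
        by (intro nonneg) auto
    qed
    with elim(1,2) show ?case using sum_at_top_if_not_summable[of "\<lambda>n. mean_draw \<phi> n \<omega>"] by simp
  qed
qed

lemma AE_not_summable_mean_draw:
  fixes \<phi> :: "nat \<Rightarrow> nat \<Rightarrow> real" and \<psi> :: "nat \<Rightarrow> real"
  assumes nonneg: "\<And>m. 1 \<le> m \<Longrightarrow> 0 \<le> \<psi> m"
    and mean_ge: "\<And>m s h. 1 \<le> m \<Longrightarrow> m \<le> s \<Longrightarrow> 1 \<le> h \<Longrightarrow> h < s \<Longrightarrow>
      \<psi> m / real s \<le> hypergeometric_expectation m s h (\<phi> m)"
  shows "AE \<omega> in M. \<not> summable (\<lambda>n. \<psi> (N (Suc n) \<omega>) / real (Suc n)) \<longrightarrow>
    \<not> summable (\<lambda>n. mean_draw \<phi> n \<omega>)"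
  using AE_N_le_S AE_S_le
proof eventually_elim
  case (elim \<omega>)
  define \<kappa> where "\<kappa> = a + b + C * C"
  have "0 < \<kappa>" using init by (simp add: \<kappa>_def)
  have \<psi>: "0 \<le> \<psi> (N (Suc n) \<omega>)" for n using elim(1) by (intro nonneg) blast
  have "\<psi> (N (Suc n) \<omega>) / real (Suc n) / \<kappa> \<le> mean_draw \<phi> n \<omega>" for n
  proof -
    have "S n \<omega> \<le> Suc n * \<kappa>" using elim(2) by (simp add: \<kappa>_def mult.commute)
    hence "real (S n \<omega>) \<le> real (Suc n) * real \<kappa>" by (simp only: of_nat_mult[symmetric] of_nat_le_iff)
    hence "\<psi> (N (Suc n) \<omega>) / (real (Suc n) * real \<kappa>) \<le> \<psi> (N (Suc n) \<omega>) / real (S n \<omega>)"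
      using \<psi> H_ge_1[of n \<omega>] by (intro divide_left_mono) auto
    also have "\<dots> \<le> mean_draw \<phi> n \<omega>" using elim(1) H_ge_1 H_less_S by (intro mean_ge) auto
    finally show ?thesis by simp
  qed
  hence "summable (\<lambda>n. \<psi> (N (Suc n) \<omega>) / real (Suc n) / \<kappa>)" if "summable (\<lambda>n. mean_draw \<phi> n \<omega>)"
    by (intro summable_comparison_test'[OF that, of 0]) (use \<psi> in simp)
  thus ?case using \<open>0 < \<kappa>\<close> by (auto simp del: of_nat_Suc divide_divide_eq_left)
qed

subsection \<open>Consistency of the empirical means\<close>

lemma AE_average_tendsto_cond_exp_limit:
  fixes \<phi> :: "nat \<Rightarrow> real"
  assumes "AE \<omega> in M. (\<lambda>n. real_cond_exp M (F n) (\<lambda>\<omega>. \<phi> (N (Suc n) \<omega>)) \<omega>) \<longlonglongrightarrow> L \<omega>"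
  shows "AE \<omega> in M. (\<lambda>n. (\<Sum>j=1..n. \<phi> (N j \<omega>)) / real n) \<longlonglongrightarrow> L \<omega>"
proof -
  obtain r where r: "\<And>n. AE \<omega> in M. \<bar>\<phi> (N (Suc n) \<omega>)\<bar> \<le> r"
    using AE_bounded_draw[of "\<lambda>i j. \<phi> i"] by blast
  have "AE \<omega> in M. filterlim (\<lambda>n. \<Sum>j<n. 1 :: real) at_top sequentially \<longrightarrow>
      (\<lambda>n. (\<Sum>j<n. \<phi> (N (Suc j) \<omega>) * 1) / (\<Sum>j<n. 1)) \<longlonglongrightarrow> L \<omega>"
  proof (rule F.AE_weighted_average_tendsto_cond_exp_limit[OF _ r _ _ assms])
    show "(\<lambda>\<omega>. \<phi> (N (Suc n) \<omega>)) \<in> borel_measurable (F (Suc n))" for n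
      by (rule borel_measurable_F_Suc(1)[of "\<lambda>i k. \<phi> i"])
    show "AE \<omega> in M. 0 \<le> (1 :: real) \<and> (1 :: real) \<le> 1" by simp
  qed simp
  thus ?thesis by (simp add: sum.atLeast1_atMost_eq filterlim_real_sequentially)
qed

lemma AE_bounded_reinforcement:
  fixes f :: "nat \<Rightarrow> nat \<Rightarrow> real"
  obtains r where "\<And>n. AE \<omega> in M. \<bar>f (A (Suc n) \<omega>) (B (Suc n) \<omega>)\<bar> \<le> r"
proof -
  obtain r where r: "\<And>i j. i \<le> C \<Longrightarrow> j \<le> C \<Longrightarrow> \<bar>f i j\<bar> \<le> r"
    using finite_box_bounded by blast
  have "AE \<omega> in M. \<bar>f (A (Suc n) \<omega>) (B (Suc n) \<omega>)\<bar> \<le> r" for n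
    using AE_le_C by eventually_elim (auto intro: r)
  thus ?thesis by (rule that)
qed

lemma cond_exp_reinforcement:
  fixes f :: "nat \<Rightarrow> nat \<Rightarrow> real"
  shows "AE \<omega> in M. real_cond_exp M (FX n) (\<lambda>\<omega>. f (A (Suc n) \<omega>) (B (Suc n) \<omega>)) \<omega>
    = (\<integral>\<omega>. f (A (Suc n) \<omega>) (B (Suc n) \<omega>) \<partial>M)"
proof (rule real_cond_exp_indep[OF AB_indep])
  let ?AB = "gen_sigma M {A (Suc n), B (Suc n)}"
  show "subalgebra M ?AB"
    using rv by (auto simp: subalgebra_def space_gen_sigma sets_gen_sigma
        intro!: sets.sigma_sets_subset dest: measurable_sets)
  show "(\<lambda>\<omega>. f (A (Suc n) \<omega>) (B (Suc n) \<omega>)) \<in> borel_measurable ?AB"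
    by (rule measurable_compose_countable2) (auto intro: measurable_gen_sigma)
  obtain r where "AE \<omega> in M. \<bar>f (A (Suc n) \<omega>) (B (Suc n) \<omega>)\<bar> \<le> r"
    using AE_bounded_reinforcement[of f] by blast
  thus "integrable M (\<lambda>\<omega>. f (A (Suc n) \<omega>) (B (Suc n) \<omega>))"
    using F.measurable_G_imp_measurable[OF borel_measurable_F_Suc(2)]
    by (intro integrable_const_bound[of _ r]) auto
qed (rule FX.cond.subalg)

lemma AE_reinforcement_average:
  fixes f \<phi> :: "nat \<Rightarrow> nat \<Rightarrow> real" and \<psi> :: "nat \<Rightarrow> real"
  assumes lim: "(\<lambda>n. \<integral>\<omega>. f (A n \<omega>) (B n \<omega>) \<partial>M) \<longlonglongrightarrow> q"
    and \<phi>_nonneg: "\<And>m k. k \<le> m \<Longrightarrow> 0 \<le> \<phi> m k" and \<psi>_nonneg: "\<And>m. 1 \<le> m \<Longrightarrow> 0 \<le> \<psi> m"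
    and mean_ge: "\<And>m s h. 1 \<le> m \<Longrightarrow> m \<le> s \<Longrightarrow> 1 \<le> h \<Longrightarrow> h < s \<Longrightarrow>
      \<psi> m / real s \<le> hypergeometric_expectation m s h (\<phi> m)"
  shows "AE \<omega> in M. \<not> summable (\<lambda>n. \<psi> (N (Suc n) \<omega>) / real (Suc n)) \<longrightarrow>
    (\<lambda>n. (\<Sum>j=1..n. f (A j \<omega>) (B j \<omega>) * \<phi> (N j \<omega>) (X j \<omega>)) / (\<Sum>j=1..n. \<phi> (N j \<omega>) (X j \<omega>))) \<longlonglongrightarrow> q"
proof -
  let ?Z = "\<lambda>n \<omega>. f (A (Suc n) \<omega>) (B (Suc n) \<omega>)" and ?v = "\<lambda>n \<omega>. \<phi> (N (Suc n) \<omega>) (X (Suc n) \<omega>)"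
  obtain r where r: "\<And>n. AE \<omega> in M. \<bar>?Z n \<omega>\<bar> \<le> r" using AE_bounded_reinforcement[of f] by blast
  obtain c where c: "\<And>n. AE \<omega> in M. \<bar>?v n \<omega>\<bar> \<le> c" using AE_bounded_draw[of \<phi>] by blast
  have "AE \<omega> in M. \<forall>n. real_cond_exp M (FX n) (?Z n) \<omega> = expectation (?Z n)"
    unfolding AE_all_countable using cond_exp_reinforcement by blast
  hence limit: "AE \<omega> in M. (\<lambda>n. real_cond_exp M (FX n) (?Z n) \<omega>) \<longlonglongrightarrow> q"
    using LIMSEQ_Suc[OF lim] by (auto elim!: eventually_mono)
  have "AE \<omega> in M. filterlim (\<lambda>n. \<Sum>j<n. ?v j \<omega>) at_top sequentially \<longrightarrow>
      (\<lambda>n. (\<Sum>j<n. ?Z j \<omega> * ?v j \<omega>) / (\<Sum>j<n. ?v j \<omega>)) \<longlonglongrightarrow> q"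
  proof (rule FX.AE_weighted_average_tendsto_cond_exp_limit[OF _ r borel_measurable_FX _ limit])
    show "?Z n \<in> borel_measurable (FX (Suc n))" for n
      by (rule measurable_F_imp_FX[OF borel_measurable_F_Suc(2)])
    show "AE \<omega> in M. 0 \<le> ?v n \<omega> \<and> ?v n \<omega> \<le> c" for n
      using c[of n] AE_X_le_N by eventually_elim (auto intro: \<phi>_nonneg)
  qed
  moreover have "AE \<omega> in M. \<not> summable (\<lambda>n. mean_draw \<phi> n \<omega>) \<longrightarrow>
      filterlim (\<lambda>n. \<Sum>j<n. ?v j \<omega>) at_top sequentially"
    by (rule AE_sum_draws_at_top[OF \<phi>_nonneg])
  moreover have "AE \<omega> in M. \<not> summable (\<lambda>n. \<psi> (N (Suc n) \<omega>) / real (Suc n)) \<longrightarrow>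
      \<not> summable (\<lambda>n. mean_draw \<phi> n \<omega>)"
    by (rule AE_not_summable_mean_draw[OF \<psi>_nonneg mean_ge])
  ultimately show ?thesis by eventually_elim (simp add: sum.atLeast1_atMost_eq)
qed

lemma AE_reinforcement_average_A:
  assumes "(\<lambda>n. \<integral>\<omega>. f (A n \<omega>) (B n \<omega>) \<partial>M) \<longlonglongrightarrow> q"
  shows "AE \<omega> in M.
    (\<lambda>n. (\<Sum>j=1..n. f (A j \<omega>) (B j \<omega>) * real (X j \<omega>)) / (\<Sum>j=1..n. real (X j \<omega>))) \<longlonglongrightarrow> q"
proof -
  have mean_ge: "1 / real s \<le> hypergeometric_expectation m s h real"
    if "1 \<le> m" "m \<le> s" "1 \<le> h" "h < s" for m s h
  proof -
    have "1 * 1 \<le> real m * real h" using that by (intro mult_mono) auto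
    thus ?thesis using that by (simp add: hypergeometric_expectation_drawn divide_right_mono)
  qed
  have "AE \<omega> in M. \<not> summable (\<lambda>n. 1 / real (Suc n)) \<longrightarrow>
      (\<lambda>n. (\<Sum>j=1..n. f (A j \<omega>) (B j \<omega>) * real (X j \<omega>)) / (\<Sum>j=1..n. real (X j \<omega>))) \<longlonglongrightarrow> q"
    by (rule AE_reinforcement_average[where \<phi> = "\<lambda>m k. real k" and \<psi> = "\<lambda>m. 1", OF assms])
       (auto intro: mean_ge)
  thus ?thesis using not_summable_one_div_Suc by (simp only: not_False_eq_True simp_thms)
qed

lemma AE_reinforcement_average_B:
  assumes "(\<lambda>n. \<integral>\<omega>. f (A n \<omega>) (B n \<omega>) \<partial>M) \<longlonglongrightarrow> q"
  shows "AE \<omega> in M. (\<lambda>n. (\<Sum>j=1..n. f (A j \<omega>) (B j \<omega>) * (real (N j \<omega>) - real (X j \<omega>)))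
    / (\<Sum>j=1..n. real (N j \<omega>) - real (X j \<omega>))) \<longlonglongrightarrow> q"
proof -
  have mean_ge: "1 / real s \<le> hypergeometric_expectation m s h (\<lambda>k. real m - real k)"
    if "1 \<le> m" "m \<le> s" "1 \<le> h" "h < s" for m s h
  proof -
    have "real h + 1 \<le> real s" using that by simp
    hence "1 * 1 \<le> real m * (real s - real h)" using that by (intro mult_mono) auto
    thus ?thesis using that by (simp add: hypergeometric_expectation_not_drawn divide_right_mono)
  qed
  have "AE \<omega> in M. \<not> summable (\<lambda>n. 1 / real (Suc n)) \<longrightarrow>
      (\<lambda>n. (\<Sum>j=1..n. f (A j \<omega>) (B j \<omega>) * (real (N j \<omega>) - real (X j \<omega>)))
        / (\<Sum>j=1..n. real (N j \<omega>) - real (X j \<omega>))) \<longlonglongrightarrow> q"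
    by (rule AE_reinforcement_average[where \<phi> = "\<lambda>m k. real m - real k" and \<psi> = "\<lambda>m. 1", OF assms])
       (auto intro: mean_ge)
  thus ?thesis using not_summable_one_div_Suc by (simp only: not_False_eq_True simp_thms)
qed

lemma AE_reinforcement_average_AB:
  assumes "(\<lambda>n. \<integral>\<omega>. f (A n \<omega>) (B n \<omega>) \<partial>M) \<longlonglongrightarrow> q"
    and average_N: "AE \<omega> in M. (\<lambda>n. (\<Sum>j=1..n. real (N j \<omega>)) / real n) \<longlonglongrightarrow> L \<omega>"
  shows "AE \<omega> in M. 1 < L \<omega> \<longrightarrow>
    (\<lambda>n. (\<Sum>j=1..n. f (A j \<omega>) (B j \<omega>) * (real (X j \<omega>) * (real (N j \<omega>) - real (X j \<omega>))))
      / (\<Sum>j=1..n. real (X j \<omega>) * (real (N j \<omega>) - real (X j \<omega>)))) \<longlonglongrightarrow> q"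
proof -
  have "AE \<omega> in M. \<not> summable (\<lambda>n. (real (N (Suc n) \<omega>) - 1) / real (Suc n)) \<longrightarrow>
      (\<lambda>n. (\<Sum>j=1..n. f (A j \<omega>) (B j \<omega>) * (real (X j \<omega>) * (real (N j \<omega>) - real (X j \<omega>))))
        / (\<Sum>j=1..n. real (X j \<omega>) * (real (N j \<omega>) - real (X j \<omega>)))) \<longlonglongrightarrow> q"
    by (rule AE_reinforcement_average[where \<phi> = "\<lambda>m k. real k * (real m - real k)"
          and \<psi> = "\<lambda>m. real m - 1", OF assms(1)])
       (auto intro: hypergeometric_expectation_product_ge)
  thus ?thesis using average_N
  proof eventually_elim
    case (elim \<omega>)
    have "(\<lambda>n. (\<Sum>j<n. real (N (Suc j) \<omega>)) / real n - 1) \<longlonglongrightarrow> L \<omega> - 1"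
      using elim(2) by (intro tendsto_intros) (simp add: sum.atLeast1_atMost_eq)
    moreover have "\<forall>\<^sub>F n in sequentially. (\<Sum>j<n. real (N (Suc j) \<omega>)) / real n - 1
        = (\<Sum>j<n. real (N (Suc j) \<omega>) - 1) / real n"
      using eventually_gt_at_top[of 0] by eventually_elim (simp add: sum_subtractf field_simps)
    ultimately have "(\<lambda>n. (\<Sum>j<n. real (N (Suc j) \<omega>) - 1) / real n) \<longlonglongrightarrow> L \<omega> - 1"
      by (rule Lim_transform_eventually)
    from not_summable_div_Suc_if_average_tendsto[OF this] elim(1) show ?case by auto
  qed
qed

end

theorem corollary3p2:
  fixes M :: "'w measure"
    and a b :: nat
    and N X A B :: "nat \<Rightarrow> 'w \<Rightarrow> nat"
    and mA mB :: real
    and Nlim Qlim :: "'w \<Rightarrow> real"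
  assumes urn: "urn_model M a b N X A B"
    and mA: "(\<lambda>n. \<integral>\<omega>. real (A n \<omega>) \<partial>M) \<longlonglongrightarrow> mA"
    and mB: "(\<lambda>n. \<integral>\<omega>. real (B n \<omega>) \<partial>M) \<longlonglongrightarrow> mB"
    and cases: "urn_case_greater M A B mA mB \<or> urn_case_equal M A B"
    and Nlim_rv: "Nlim \<in> borel_measurable M" and Nlim_pos: "AE \<omega> in M. Nlim \<omega> > 0"
    and Qlim_rv: "Qlim \<in> borel_measurable M" and Qlim_pos: "AE \<omega> in M. Qlim \<omega> > 0"
    and N_lim: "AE \<omega> in M.
      (\<lambda>n. real_cond_exp M (urn_F M N X A B n) (\<lambda>\<omega>. real (N (Suc n) \<omega>)) \<omega>) \<longlonglongrightarrow> Nlim \<omega>"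
    and Q_lim: "AE \<omega> in M.
      (\<lambda>n. real_cond_exp M (urn_F M N X A B n) (\<lambda>\<omega>. (real (N (Suc n) \<omega>))\<^sup>2) \<omega>) \<longlonglongrightarrow> Qlim \<omega>"
  shows
    "((AE \<omega> in M. (\<lambda>n. (\<Sum>j=1..n. real (N j \<omega>)) / real n) \<longlonglongrightarrow> Nlim \<omega>) \<and>
      (AE \<omega> in M. (\<lambda>n. (\<Sum>j=1..n. (real (N j \<omega>))\<^sup>2) / real n) \<longlonglongrightarrow> Qlim \<omega>)) \<and>
     ((AE \<omega> in M. (\<lambda>n. (\<Sum>j=1..n. real (A j \<omega>) * real (X j \<omega>))
                        / (\<Sum>j=1..n. real (X j \<omega>))) \<longlonglongrightarrow> mA) \<and>
      (AE \<omega> in M. (\<lambda>n. (\<Sum>j=1..n. real (B j \<omega>) * (real (N j \<omega>) - real (X j \<omega>)))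
                        / (\<Sum>j=1..n. real (N j \<omega>) - real (X j \<omega>))) \<longlonglongrightarrow> mB)) \<and>
     (\<forall>qA qB.
       ((\<lambda>n. \<integral>\<omega>. (real (A n \<omega>))\<^sup>2 \<partial>M) \<longlonglongrightarrow> qA) \<and>
       ((\<lambda>n. \<integral>\<omega>. (real (B n \<omega>))\<^sup>2 \<partial>M) \<longlonglongrightarrow> qB) \<longrightarrow>
       (AE \<omega> in M. (\<lambda>n. (\<Sum>j=1..n. (real (A j \<omega>))\<^sup>2 * real (X j \<omega>))
                        / (\<Sum>j=1..n. real (X j \<omega>))) \<longlonglongrightarrow> qA) \<and>
       (AE \<omega> in M. (\<lambda>n. (\<Sum>j=1..n. (real (B j \<omega>))\<^sup>2 * (real (N j \<omega>) - real (X j \<omega>)))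
                        / (\<Sum>j=1..n. real (N j \<omega>) - real (X j \<omega>))) \<longlonglongrightarrow> qB)) \<and>
     (\<forall>qAB.
       ((\<lambda>n. \<integral>\<omega>. real (A n \<omega>) * real (B n \<omega>) \<partial>M) \<longlonglongrightarrow> qAB) \<and>
       measure M {\<omega> \<in> space M. Nlim \<omega> = 1} < 1 \<longrightarrow>
       (AE \<omega> in M. Nlim \<omega> > 1 \<longrightarrow>
          (\<lambda>n. (\<Sum>j=1..n. real (A j \<omega>) * real (B j \<omega>) * real (X j \<omega>) * (real (N j \<omega>) - real (X j \<omega>)))
                / (\<Sum>j=1..n. real (X j \<omega>) * (real (N j \<omega>) - real (X j \<omega>)))) \<longlonglongrightarrow> qAB))"
proof -
  interpret urn_model M a b N X A B by (rule urn)
  have average_N: "AE \<omega> in M. (\<lambda>n. (\<Sum>j=1..n. real (N j \<omega>)) / real n) \<longlonglongrightarrow> Nlim \<omega>"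
    by (rule AE_average_tendsto_cond_exp_limit[OF N_lim])
  note average_N_square = AE_average_tendsto_cond_exp_limit[OF Q_lim]
  note means = AE_reinforcement_average_A[of "\<lambda>x y. real x", OF mA]
    AE_reinforcement_average_B[of "\<lambda>x y. real y", OF mB]
  note second_moments = AE_reinforcement_average_A[of "\<lambda>x y. (real x)\<^sup>2"]
    AE_reinforcement_average_B[of "\<lambda>x y. (real y)\<^sup>2"]
  note mixed_moment = AE_reinforcement_average_AB[of "\<lambda>x y. real x * real y", OF _ average_N,
      unfolded mult.assoc[symmetric]]
  show ?thesis
    by (intro conjI allI impI average_N average_N_square means second_moments mixed_moment) auto
qed

end
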